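(* In the homogeneous multi-sensor model described in the context, with change point $\nu$, the log-likelihood ratio of the observations up to slot $n$ satisfies $$l_{\nu,n}:=\log\frac{\mathbb P_\nu(U_1^n,Y_1^n,J_1^n,Z_1^n\mid\boldsymbol Q_1)}{\mathbb P_\infty(U_1^n,Y_1^n,J_1^n,Z_1^n\mid\boldsymbol Q_1)}=\sum_{k=1}^n\left(\mathbf 1_{\{\|\boldsymbol Q_k\|_0>0\}}\log\frac{\mathbb P_\nu(Y_k\mid\|\boldsymbol Q_k\|_0>0)}{\mathbb P_\infty(Y_k\mid\|\boldsymbol Q_k\|_0>0)}+\mathbf 1_{\{Y_k=1,\ J_k>Q_{1,U_k}+S_{\nu,U_k}\}}\log\frac{f_1(X_{J_k,U_k})}{f_0(X_{J_k,U_k})}\right).$$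
   Context: There are $L$ sensors, set $\mathcal L$, with synchronous unit time slots. In each slot each sensor independently samples a measurement with probability $r$, $0<r<1$; the measurement is placed in that sensor's own transmit queue. The measurements are independent across sensors and time, with density $f_0$ if sampled in a slot $\le\nu$ and $f_1$ if sampled in a slot $>\nu$, where $\nu$ is the deterministic change point. $\boldsymbol Q_k=(Q_{k,1},\dots,Q_{k,L})$ is the vector of queue lengths at the start of slot $k$; $\|\boldsymbol Q_k\|_0$ is its number of nonzero entries. In each slot with $\|\boldsymbol Q_k\|_0>0$, one sensor is chosen uniformly at random among those with non-empty queues, and transmits a packet to the decision maker over a shared channel; failed packets remain queued for retransmission. $Y_k=1,0,\emptyset$ according as the transmission in slot $k$ succeeds, fails, or there is none. The channel is memoryless, independent of the sampling process given $\nu$, with $\mathbb P(Y_k=1\mid\|\boldsymbol Q_k\|_0>0)=p_0$ for $k\le\nu$ and $p_1$ for $k>\nu$; stability requires $Lr<\min\{p_0,p_1\}$. The decision maker observes $(U_k,Y_k,J_k,Z_k)$ at the end of slot $k$: on success, $U_k$ is the index of the sensor whose measurement is received, $J_k$ is the sampling index of that measurement (numbered sequentially for that sensor, starting with the packets in its queue at the start of slot 1), and $Z_k=X_{J_k,U_k}$ is the measurement; otherwise $U_k=J_k=Z_k=*$. $Q_{1,l}$ is the initial queue length of sensor $l$ and $S_{\nu,l}$ is the number of measurements that arrive in the queue of sensor $l$ during slots $1,\dots,\nu$. $\mathbb P_\nu$ is the law with change point $\nu$; $\mathbb P_\infty$ the law with no change; $\mathbb P(\cdot\mid\cdot)$ of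 observations stands for the conditional joint mass/density. $U_1^n=(U_1,\dots,U_n)$, etc.
   Formalization: The likelihoods are conditioned on the arrival counts S_ν as well as on Q_1, since the right-hand side depends on S_ν, which the observations do not determine and without which the identity is false; the identity is stated almost surely under both laws. *)

theory Defs
  imports "HOL-Probability.Probability"
begin

text \<open>Logarithm on \<open>[0, \<infinity>]\<close>. Neither mutual absolute continuity of the two measurement laws nor
  success probabilities below 1 are assumed, so log-likelihood ratios may take the values
  \<open>\<plusminus>\<infinity>\<close>.\<close>

definition eln :: "ennreal \<Rightarrow> ereal" where
  "eln x = (if x = 0 then -\<infinity> else if x = top then \<infinity> else ereal (ln (enn2real x)))"


text \<open>The reference measure \<open>\<mu>\<close>, enlarged by an atom of mass 1 at the symbol \<open>*\<close>
  (rendered \<^const>\<open>None\<close>).\<close>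

definition option_measure :: "'x measure \<Rightarrow> 'x option measure" where
  "option_measure \<mu> =
     measure_of (insert None (Some ` space \<mu>))
       {B. B \<subseteq> insert None (Some ` space \<mu>) \<and> Some -` B \<in> sets \<mu>}
       (\<lambda>B. emeasure \<mu> (Some -` B) + indicator B None)"

lemma space_option_measure: "space (option_measure \<mu>) = insert None (Some ` space \<mu>)"
  and sets_option_measure:
    "sets (option_measure \<mu>) = {B. B \<subseteq> insert None (Some ` space \<mu>) \<and> Some -` B \<in> sets \<mu>}"
    (is "_ = ?A")
  and emeasure_option_measure:
    "B \<in> sets (option_measure \<mu>) \<Longrightarrow>
       emeasure (option_measure \<mu>) B = emeasure \<mu> (Some -` B) + indicator B None"
proof -
  let ?O = "insert None (Some ` space \<mu>)"
  let ?m = "\<lambda>B. emeasure \<mu> (Some -` B) + indicator B None :: ennreal"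
  have [simp]: "Some -` (?O - B) = space \<mu> - Some -` B" for B by auto
  have sa: "sigma_algebra ?O ?A"
    by (rule sigma_algebra_iff2[THEN iffD2]) (auto simp: vimage_Union vimage_UN)
  then interpret sigma_algebra ?O ?A .
  show "space (option_measure \<mu>) = ?O"
    unfolding option_measure_def by (rule space_measure_of) auto
  show sets: "sets (option_measure \<mu>) = ?A"
    unfolding option_measure_def by simp
  have "countably_additive ?A ?m"
  proof (rule countably_additiveI)
    fix B :: "nat \<Rightarrow> 'a option set"
    assume B: "range B \<subseteq> ?A" "disjoint_family B"
    have "(\<Sum>i. emeasure \<mu> (Some -` B i)) = emeasure \<mu> (\<Union>i. Some -` B i)"
      using B by (intro suminf_emeasure) (auto simp: disjoint_family_on_def, blast)
    moreover have "(\<Sum>i. indicator (B i) None :: ennreal) = indicator (\<Union>i. B i) None"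
      using B by (intro suminf_indicator)
    ultimately show "(\<Sum>i. ?m (B i)) = ?m (\<Union>i. B i)"
      by (subst suminf_add[symmetric]) (auto simp: vimage_UN)
  qed
  then show "emeasure (option_measure \<mu>) B = ?m B" if "B \<in> sets (option_measure \<mu>)"
    using that unfolding option_measure_def
    by (intro emeasure_measure_of_sigma[OF sa])
       (auto simp: positive_def sets[unfolded option_measure_def])
qed


text \<open>Slots and packet indices are numbered from 1. The primitive random variables:

  \<^item> \<open>init_queue S \<omega> l\<close>: the initial queue length of sensor \<open>l\<close>;
  \<^item> \<open>sampled S k l\<close>: sensor \<open>l\<close> takes a sample in slot \<open>k\<close>;
  \<^item> \<open>reading S k l\<close>: the value sensor \<open>l\<close> obtains if it samples in slot \<open>k\<close>;
  \<^item> \<open>init_reading S j l\<close>: the value carried by the \<open>j\<close>-th packet that is in the queue of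
    sensor \<open>l\<close> at the start of slot 1;
  \<^item> \<open>channel S k\<close>: a transmission in slot \<open>k\<close>, if there is one, succeeds;
  \<^item> \<open>pick S k N\<close>: the sensor chosen in slot \<open>k\<close> if \<open>N\<close> is the set of sensors with
    non-empty queues.\<close>

record ('w, 'l, 'x) sensor_system =
  init_queue :: "'w \<Rightarrow> 'l \<Rightarrow> nat"
  sampled :: "nat \<Rightarrow> 'l \<Rightarrow> 'w \<Rightarrow> bool"
  reading :: "nat \<Rightarrow> 'l \<Rightarrow> 'w \<Rightarrow> 'x"
  init_reading :: "nat \<Rightarrow> 'l \<Rightarrow> 'w \<Rightarrow> 'x"
  channel :: "nat \<Rightarrow> 'w \<Rightarrow> bool"
  pick :: "nat \<Rightarrow> 'l set \<Rightarrow> 'w \<Rightarrow> 'l"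

definition support :: "('l \<Rightarrow> nat) \<Rightarrow> 'l set" where
  "support q = {l. q l \<noteq> 0}"

definition norm0 :: "('l \<Rightarrow> nat) \<Rightarrow> nat" where
  "norm0 q = card (support q)"

text \<open>Queue lengths at the start of a slot. The transmission in slot \<open>k\<close> is decided by the
  queues at the start of slot \<open>k\<close>; samples taken in slot \<open>k\<close> are first available in slot
  \<open>k + 1\<close>. The value at slot 0 is a dummy.\<close>

fun queue :: "('w, 'l, 'x) sensor_system \<Rightarrow> nat \<Rightarrow> 'w \<Rightarrow> 'l \<Rightarrow> nat" where
  "queue S 0 \<omega> = init_queue S \<omega>"
| "queue S (Suc 0) \<omega> = init_queue S \<omega>"
| "queue S (Suc (Suc k)) \<omega> =
     (let q = queue S (Suc k) \<omega> in
      (\<lambda>l. q l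
          - of_bool (norm0 q > 0 \<and> channel S (Suc k) \<omega> \<and> pick S (Suc k) (support q) \<omega> = l)
          + of_bool (sampled S (Suc k) l \<omega>)))"

definition obs_Y :: "('w, 'l, 'x) sensor_system \<Rightarrow> nat \<Rightarrow> 'w \<Rightarrow> bool option" where
  "obs_Y S k \<omega> = (if norm0 (queue S k \<omega>) > 0 then Some (channel S k \<omega>) else None)"

definition obs_U :: "('w, 'l, 'x) sensor_system \<Rightarrow> nat \<Rightarrow> 'w \<Rightarrow> 'l option" where
  "obs_U S k \<omega> =
     (if obs_Y S k \<omega> = Some True then Some (pick S k (support (queue S k \<omega>)) \<omega>) else None)"

text \<open>Queues are first-in first-out, so the index of the packet delivered in slot \<open>k\<close> is the
  number of packets of that sensor delivered in slots \<open>1, \<dots>, k\<close>.\<close>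

definition obs_J :: "('w, 'l, 'x) sensor_system \<Rightarrow> nat \<Rightarrow> 'w \<Rightarrow> nat option" where
  "obs_J S k \<omega> =
     map_option (\<lambda>l. card {i \<in> {1..k}. obs_U S i \<omega> = Some l}) (obs_U S k \<omega>)"

definition arrivals :: "('w, 'l, 'x) sensor_system \<Rightarrow> nat \<Rightarrow> 'w \<Rightarrow> 'l \<Rightarrow> nat" where
  "arrivals S n \<omega> l = card {k \<in> {1..n}. sampled S k l \<omega>}"

text \<open>The measurement in packet \<open>j\<close> of sensor \<open>l\<close>; for packets that are not initially
  present, the least slot below is the one in which that packet is sampled.\<close>

definition packet :: "('w, 'l, 'x) sensor_system \<Rightarrow> nat \<Rightarrow> 'l \<Rightarrow> 'w \<Rightarrow> 'x" where
  "packet S j l \<omega> =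
     (if j \<le> init_queue S \<omega> l then init_reading S j l \<omega>
      else reading S (LEAST k. j \<le> init_queue S \<omega> l + arrivals S k \<omega> l) l \<omega>)"

definition obs_Z :: "('w, 'l, 'x) sensor_system \<Rightarrow> nat \<Rightarrow> 'w \<Rightarrow> 'x option" where
  "obs_Z S k \<omega> =
     map_option (\<lambda>l. packet S (the (obs_J S k \<omega>)) l \<omega>) (obs_U S k \<omega>)"

definition observations ::
    "('w, 'l, 'x) sensor_system \<Rightarrow> nat \<Rightarrow> 'w \<Rightarrow>
       nat \<Rightarrow> 'l option \<times> bool option \<times> nat option \<times> 'x option" where
  "observations S n \<omega> =
     (\<lambda>k\<in>{1..n}. (obs_U S k \<omega>, obs_Y S k \<omega>, obs_J S k \<omega>, obs_Z S k \<omega>))"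

definition obs_measure ::
    "'x measure \<Rightarrow> nat \<Rightarrow>
       (nat \<Rightarrow> 'l option \<times> bool option \<times> nat option \<times> 'x option) measure" where
  "obs_measure \<mu> n =
     (\<Pi>\<^sub>M k\<in>{1..n}. count_space UNIV \<Otimes>\<^sub>M count_space UNIV \<Otimes>\<^sub>M count_space UNIV \<Otimes>\<^sub>M
        option_measure \<mu>)"


text \<open>Names of the primitive random variables that enter the dynamics.\<close>

datatype 'l source =
    Init | Sampled nat 'l | Reading nat 'l | InitReading nat 'l | Channel nat | Pick nat "'l set"

definition sources :: "'l source set" where
  "sources =
     {Init} \<union> {Sampled k l | k l. 1 \<le> k} \<union> {Reading k l | k l. 1 \<le> k} \<union>
     {InitReading j l | j l. 1 \<le> j} \<union> {Channel k | k. 1 \<le> k} \<union>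
     {Pick k N | k N. 1 \<le> k \<and> N \<noteq> {}}"

fun source_events ::
    "'w measure \<Rightarrow> 'x measure \<Rightarrow> ('w, 'l, 'x) sensor_system \<Rightarrow> 'l source \<Rightarrow> 'w set set" where
  "source_events M \<mu> S Init = sets (vimage_algebra (space M) (init_queue S) (count_space UNIV))"
| "source_events M \<mu> S (Sampled k l) =
     sets (vimage_algebra (space M) (sampled S k l) (count_space UNIV))"
| "source_events M \<mu> S (Reading k l) = sets (vimage_algebra (space M) (reading S k l) \<mu>)"
| "source_events M \<mu> S (InitReading j l) =
     sets (vimage_algebra (space M) (init_reading S j l) \<mu>)"
| "source_events M \<mu> S (Channel k) =
     sets (vimage_algebra (space M) (channel S k) (count_space UNIV))"
| "source_events M \<mu> S (Pick k N) =
     sets (vimage_algebra (space M) (pick S k N) (count_space UNIV))"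

text \<open>\<open>M\<close> is the law with change point \<open>\<nu>\<close>, where \<open>\<nu> = \<infinity>\<close> means no change.
  Packets queued before slot 1 are sampled before the change.\<close>

locale sensor_law = prob_space M
  for M :: "'w measure" and \<nu> :: enat
    and \<mu> :: "'x measure" and f\<^sub>0 f\<^sub>1 :: "'x \<Rightarrow> ennreal"
    and \<pi> :: "('l::finite \<Rightarrow> nat) pmf" and r p\<^sub>0 p\<^sub>1 :: real
    and S :: "('w, 'l, 'x) sensor_system" +
  assumes init_measurable: "init_queue S \<in> M \<rightarrow>\<^sub>M count_space UNIV"
    and init_law: "distr M (count_space UNIV) (init_queue S) = measure_pmf \<pi>"
    and sampled_measurable: "1 \<le> k \<Longrightarrow> sampled S k l \<in> M \<rightarrow>\<^sub>M count_space UNIV"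
    and sampled_law:
      "1 \<le> k \<Longrightarrow> distr M (count_space UNIV) (sampled S k l) = measure_pmf (bernoulli_pmf r)"
    and reading_law:
      "1 \<le> k \<Longrightarrow> distributed M \<mu> (reading S k l) (if enat k \<le> \<nu> then f\<^sub>0 else f\<^sub>1)"
    and init_reading_law: "1 \<le> j \<Longrightarrow> distributed M \<mu> (init_reading S j l) f\<^sub>0"
    and channel_measurable: "1 \<le> k \<Longrightarrow> channel S k \<in> M \<rightarrow>\<^sub>M count_space UNIV"
    and channel_law:
      "1 \<le> k \<Longrightarrow> distr M (count_space UNIV) (channel S k)
         = measure_pmf (bernoulli_pmf (if enat k \<le> \<nu> then p\<^sub>0 else p\<^sub>1))"
    and pick_measurable: "1 \<le> k \<Longrightarrow> N \<noteq> {} \<Longrightarrow> pick S k N \<in> M \<rightarrow>\<^sub>M count_space UNIV"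
    and pick_nonempty: "1 \<le> k \<Longrightarrow> N \<noteq> {} \<Longrightarrow> \<omega> \<in> space M \<Longrightarrow> pick S k N \<omega> \<in> N"
    and pick_law:
      "1 \<le> k \<Longrightarrow> N \<noteq> {} \<Longrightarrow>
         distr M (count_space UNIV) (pick S k N) = measure_pmf (pmf_of_set N)"
    and independent: "indep_sets (source_events M \<mu> S) sources"


text \<open>Density of \<open>X\<close> with respect to \<open>N\<close>, conditionally on the event \<open>B\<close>. It is determined
  only \<open>N\<close>-almost everywhere, hence the almost-sure form of results about it.\<close>

definition cond_density :: "'w measure \<Rightarrow> 'w set \<Rightarrow> 'a measure \<Rightarrow> ('w \<Rightarrow> 'a) \<Rightarrow> 'a \<Rightarrow> ennreal" where
  "cond_density M B N X = RN_deriv N (distr (uniform_measure M B) N X)"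

text \<open>Besides the initial queue lengths, the conditioning event fixes the numbers of arrivals
  up to the change point, which the observations do not determine. Without this, the
  likelihood would be a mixture over those numbers and the ratio would not factorize.\<close>

definition obs_likelihood ::
    "'w measure \<Rightarrow> 'x measure \<Rightarrow> ('w, 'l, 'x) sensor_system \<Rightarrow> nat \<Rightarrow> nat \<Rightarrow> 'w \<Rightarrow> ennreal" where
  "obs_likelihood M \<mu> S \<nu> n \<omega> =
     cond_density M
       {\<omega>' \<in> space M. init_queue S \<omega>' = init_queue S \<omega> \<and> arrivals S \<nu> \<omega>' = arrivals S \<nu> \<omega>}
       (obs_measure \<mu> n) (observations S n) (observations S n \<omega>)"

definition log_likelihood_ratio ::
    "(enat \<Rightarrow> 'w measure) \<Rightarrow> 'x measure \<Rightarrow> ('w, 'l, 'x) sensor_system \<Rightarrow> nat \<Rightarrow> nat \<Rightarrow> 'w \<Rightarrow> ereal"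
  where
  "log_likelihood_ratio Pr \<mu> S \<nu> n \<omega> =
     eln (obs_likelihood (Pr (enat \<nu>)) \<mu> S \<nu> n \<omega> / obs_likelihood (Pr \<infinity>) \<mu> S \<nu> n \<omega>)"

text \<open>The probability of the outcome of slot \<open>k\<close> seen in \<open>\<omega>\<close>, given that there is a
  transmission in slot \<open>k\<close>.\<close>

definition channel_likelihood ::
    "'w measure \<Rightarrow> ('w, 'l, 'x) sensor_system \<Rightarrow> nat \<Rightarrow> 'w \<Rightarrow> ennreal" where
  "channel_likelihood M S k \<omega> =
     ennreal (\<P>(\<omega>' in M. obs_Y S k \<omega>' = obs_Y S k \<omega> \<bar> norm0 (queue S k \<omega>') > 0))"

end

theory Submission
  imports Defs
begin

text \<open>Prescribing the channel outcomes of a record \<open>(u, y, j)\<close> turns the event of observing it into the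
  intersection of an event of the initial queues, arrivals and picks with the events that
  the channel takes the values \<open>y k\<close> in the busy slots. On each atom of the former the delivered packets
  come from distinct, fixed sources, independent of everything else; a packet has density \<open>f\<^sub>0\<close>
  exactly if its index is at most \<open>q l + a l\<close>, where \<open>q\<close> are the initial queue lengths and \<open>a\<close> the
  arrivals up to the change point. Hence, given \<open>q\<close> and \<open>a\<close>, the observations have a density that is
  a product of channel probabilities, measurement densities and a factor which does not depend on the
  law and cancels in the ratio.\<close>

section \<open>Densities and the observation space\<close>

text \<open>Two obstacles shape the argument. The packet named by a record may be sampled in
  different slots on different atoms, so its source varies with the atom. What stays fixed is the
  side of the change point on which that slot lies: cumulative arrivals grow by at most one per
  slot, so the index of a packet decides whether it is sampled by slot \<open>c\<close>. Hence the
  conditional probability is one constant for all atoms. The lemmas carry \<open>c\<close> next to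
  the change point of the law, with \<open>\<nu> \<in> {enat c, \<infinity>}\<close>, since both
  laws are conditioned on the same arrivals up to \<open>c\<close>. Secondly, likelihoods are
  Radon-Nikodym derivatives, fixed only almost everywhere, and the two laws of the observations need
  not be mutually absolutely continuous. Both derivatives are therefore identified almost everywhere
  for the common reference measure and only then transferred to the law at hand. Under that law its
  own density is almost surely positive, so either all numerators or all denominators of the slot
  ratios are nonzero; this rules out \<open>0 * top\<close> in the product and opposite infinities
  in the sum.\<close>

lemma eln_mult:
  assumes "(x \<noteq> top \<and> y \<noteq> top) \<or> (x \<noteq> 0 \<and> y \<noteq> 0)"
  shows "eln (x * y) = eln x + eln y"
proof (cases "x = 0 \<or> x = top \<or> y = 0 \<or> y = top")
  case True
  then show ?thesis
    using assms by (auto simp: eln_def ennreal_mult_eq_top_iff)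
next
  case False
  then have "0 < enn2real x" "0 < enn2real y"
    by (auto simp: enn2real_positive_iff less_top zero_less_iff_neq_zero)
  with False show ?thesis
    by (auto simp: eln_def ennreal_mult_eq_top_iff enn2real_mult ln_mult)
qed

lemma eln_one [simp]: "eln 1 = 0"
  by (simp add: eln_def)

lemma eln_divide_self: "x \<noteq> 0 \<Longrightarrow> x \<noteq> top \<Longrightarrow> eln (x / x) = 0"
  by (simp add: ennreal_divide_self less_top)

text \<open>Finite factors have a finite product and nonzero factors a nonzero one, so either
  alternative passes to partial products and no step meets \<open>0 * top\<close>, where additivity
  of \<open>eln\<close> fails in \<open>ereal\<close>.\<close>

lemma eln_prod:
  assumes "finite I" and "(\<forall>i\<in>I. x i \<noteq> top) \<or> (\<forall>i\<in>I. x i \<noteq> 0)"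
  shows "eln (\<Prod>i\<in>I. x i) = (\<Sum>i\<in>I. eln (x i))"
  using assms
proof (induction I)
  case (insert i I)
  have "(x i \<noteq> top \<and> prod x I \<noteq> top) \<or> (x i \<noteq> 0 \<and> prod x I \<noteq> 0)"
    using insert.prems insert.hyps by (auto simp: ennreal_prod_eq_top)
  then have "eln (x i * prod x I) = eln (x i) + eln (prod x I)"
    by (rule eln_mult)
  then show ?case
    using insert by auto
qed simp

text \<open>Infinite denominators are excluded because \<open>0 * top = 0\<close> has inverse
  \<open>top\<close>, while the inverses multiply to \<open>top * 0 = 0\<close>. Zero denominators
  are harmless.\<close>

lemma ennreal_mult_divide_mult:
  fixes a b c d :: ennreal
  assumes "c \<noteq> top" "d \<noteq> top"
  shows "(a * b) / (c * d) = (a / c) * (b / d)"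
  using assms by (simp add: divide_ennreal_def ennreal_inverse_mult less_top ac_simps)

lemma ennreal_prod_divide_prod:
  fixes a b :: "'i \<Rightarrow> ennreal"
  assumes "finite I" "\<And>i. i \<in> I \<Longrightarrow> b i \<noteq> top"
  shows "(\<Prod>i\<in>I. a i) / (\<Prod>i\<in>I. b i) = (\<Prod>i\<in>I. a i / b i)"
  using assms
proof (induction I)
  case (insert i I)
  then have "prod b I \<noteq> top"
    by (auto simp: ennreal_prod_eq_top)
  with insert show ?case
    by (simp add: ennreal_mult_divide_mult)
qed simp

section \<open>The reference measure with an added atom, and integration over one slot\<close>

lemma measurable_option_measure:
  assumes "\<And>x. x \<in> space \<mu> \<Longrightarrow> g (Some x) \<in> space L" "g None \<in> space L"
    and "(\<lambda>x. g (Some x)) \<in> \<mu> \<rightarrow>\<^sub>M L"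
  shows "g \<in> option_measure \<mu> \<rightarrow>\<^sub>M L"
proof (rule measurableI)
  fix A assume A: "A \<in> sets L"
  have "Some -` (g -` A \<inter> space (option_measure \<mu>)) = (\<lambda>x. g (Some x)) -` A \<inter> space \<mu>"
    by (auto simp: space_option_measure)
  then show "g -` A \<inter> space (option_measure \<mu>) \<in> sets (option_measure \<mu>)"
    using measurable_sets[OF assms(3) A] by (auto simp: sets_option_measure space_option_measure)
qed (use assms in \<open>auto simp: space_option_measure\<close>)

lemma measurable_Some: "Some \<in> \<mu> \<rightarrow>\<^sub>M option_measure \<mu>"
proof (rule measurableI)
  fix A assume "A \<in> sets (option_measure \<mu>)"
  moreover from this have "Some -` A \<inter> space \<mu> = Some -` A"
    using sets.sets_into_space by (auto simp: sets_option_measure)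
  ultimately show "Some -` A \<inter> space \<mu> \<in> sets \<mu>"
    by (simp add: sets_option_measure)
qed (auto simp: space_option_measure)

text \<open>On indicators this is the definition of the measure, with an atom of mass 1 at
  \<open>None\<close>; linearity and monotone convergence do the rest.\<close>

lemma nn_integral_option_measure:
  assumes "g \<in> borel_measurable (option_measure \<mu>)"
  shows "(\<integral>\<^sup>+z. g z \<partial>option_measure \<mu>) = (\<integral>\<^sup>+x. g (Some x) \<partial>\<mu>) + g None"
  using assms
proof (induction rule: borel_measurable_induct)
  case (cong f g)
  have "integral\<^sup>N (option_measure \<mu>) f = integral\<^sup>N (option_measure \<mu>) g"
    using cong by (intro nn_integral_cong) auto
  moreover have "(\<integral>\<^sup>+x. f (Some x) \<partial>\<mu>) = (\<integral>\<^sup>+x. g (Some x) \<partial>\<mu>)"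
    using cong by (intro nn_integral_cong) (auto simp: space_option_measure)
  moreover have "f None = g None"
    using cong by (auto simp: space_option_measure)
  ultimately show ?case
    using cong by simp
next
  case (set A)
  have "(\<integral>\<^sup>+x. indicator A (Some x) \<partial>\<mu>) = (\<integral>\<^sup>+x. indicator (Some -` A) x \<partial>\<mu>)"
    by (intro nn_integral_cong) (auto split: split_indicator)
  then show ?case
    using set by (simp add: emeasure_option_measure sets_option_measure)
next
  case (mult u c)
  then show ?case
    using measurable_compose[OF measurable_Some mult(2)]
    by (simp add: nn_integral_cmult distrib_left)
next
  case (add u v)
  then show ?case
    using measurable_compose[OF measurable_Some add(1)] measurable_compose[OF measurable_Some add(3)]
    by (simp add: nn_integral_add ac_simps)
next
  case (seq U)
  have inc: "incseq (\<lambda>i. U i z)" for z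
    using seq(3) by (auto simp: incseq_def le_fun_def)
  have SUP: "(SUP i. U i) = (\<lambda>z. SUP i. U i z)"
    by (rule ext) (simp only: SUP_apply)
  have "(\<integral>\<^sup>+z. (SUP i. U i) z \<partial>option_measure \<mu>) = (SUP i. integral\<^sup>N (option_measure \<mu>) (U i))"
    unfolding SUP by (rule nn_integral_monotone_convergence_SUP[OF seq(3,1)])
  also have "\<dots> = (SUP i. (\<integral>\<^sup>+x. U i (Some x) \<partial>\<mu>) + U i None)"
    using seq by simp
  also have "\<dots> = (SUP i. \<integral>\<^sup>+x. U i (Some x) \<partial>\<mu>) + (SUP i. U i None)"
    by (intro ennreal_SUP_add incseq_nn_integral) (use inc seq(3) in \<open>auto simp: incseq_def le_fun_def\<close>)
  also have "(SUP i. \<integral>\<^sup>+x. U i (Some x) \<partial>\<mu>) = (\<integral>\<^sup>+x. (SUP i. U i (Some x)) \<partial>\<mu>)"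
    using seq measurable_compose[OF measurable_Some seq(1)]
    by (intro nn_integral_monotone_convergence_SUP[symmetric]) (auto simp: incseq_def le_fun_def)
  finally show ?case
    by (simp add: image_comp)
qed

lemma sigma_finite_option_measure:
  assumes "sigma_finite_measure \<mu>"
  shows "sigma_finite_measure (option_measure \<mu>)"
proof -
  obtain A where A: "countable A" "A \<subseteq> sets \<mu>" "\<Union>A = space \<mu>" "\<forall>a\<in>A. emeasure \<mu> a \<noteq> \<infinity>"
    using sigma_finite_measure.sigma_finite_countable[OF assms] by auto
  have sub: "a \<subseteq> space \<mu>" if "a \<in> A" for a
    using A(2) that sets.sets_into_space by blast
  let ?A = "insert {None} ((`) Some ` A)"
  have [simp]: "Some -` Some ` a = a" for a :: "'a set"
    by (auto simp: inj_vimage_image_eq)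
  have [simp]: "Some -` {None} = {}"
    by auto
  have S: "?A \<subseteq> sets (option_measure \<mu>)"
    using A sub by (auto simp: sets_option_measure)
  have "countable ?A"
    using A(1) by simp
  moreover have "\<Union>?A = space (option_measure \<mu>)"
    unfolding space_option_measure A(3)[symmetric] by auto
  moreover have "\<forall>a\<in>?A. emeasure (option_measure \<mu>) a \<noteq> \<infinity>"
    using A(4) S by (auto simp: emeasure_option_measure)
  ultimately show ?thesis
    using S by unfold_locales (intro exI[of _ ?A], simp)
qed

abbreviation slot_measure ::
    "'x measure \<Rightarrow> ('l option \<times> bool option \<times> nat option \<times> 'x option) measure" where
  "slot_measure \<mu> \<equiv>
     count_space UNIV \<Otimes>\<^sub>M count_space UNIV \<Otimes>\<^sub>M count_space UNIV \<Otimes>\<^sub>M option_measure \<mu>"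

lemma sigma_finite_slot_measure:
  assumes "sigma_finite_measure \<mu>"
  shows "sigma_finite_measure
    (slot_measure \<mu> :: ('l::countable option \<times> bool option \<times> nat option \<times> 'x option) measure)"
  by (intro sigma_finite_pair_measure sigma_finite_measure_count_space_countable
      sigma_finite_option_measure assms) auto

text \<open>By Fubini the integral over the counting measure collapses to the point
  \<open>a\<close>. Used three times, this removes the discrete components of an observation one by
  one.\<close>

lemma nn_integral_count_space_pair_singleton:
  fixes a :: "'c::countable"
  assumes "sigma_finite_measure L" "g \<in> borel_measurable (count_space UNIV \<Otimes>\<^sub>M L)" "B \<in> sets L"
  shows "(\<integral>\<^sup>+w. g w * indicator ({a} \<times> B) w \<partial>(count_space UNIV \<Otimes>\<^sub>M L))
    = (\<integral>\<^sup>+w. g (a, w) * indicator B w \<partial>L)"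
proof -
  interpret sigma_finite_measure L by fact
  note [measurable] = assms(2,3)
  have [measurable]: "{a} \<times> B \<in> sets (count_space UNIV \<Otimes>\<^sub>M L)"
    by simp
  have "(\<integral>\<^sup>+w. g w * indicator ({a} \<times> B) w \<partial>(count_space UNIV \<Otimes>\<^sub>M L))
    = (\<integral>\<^sup>+x. \<integral>\<^sup>+w. g (x, w) * indicator ({a} \<times> B) (x, w) \<partial>L \<partial>count_space UNIV)"
    by (intro nn_integral_fst[symmetric]) measurable
  also have "\<dots> = (\<integral>\<^sup>+x. (\<integral>\<^sup>+w. g (x, w) * indicator B w \<partial>L) * indicator {a} x \<partial>count_space UNIV)"
    by (intro nn_integral_cong) (simp add: indicator_times split: split_indicator)
  finally show ?thesis
    by simp
qed

lemma nn_integral_slot_measure: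
  fixes u :: "'l::countable option"
  assumes "sigma_finite_measure \<mu>" "g \<in> borel_measurable (slot_measure \<mu>)"
    and "A \<in> sets (option_measure \<mu>)"
  shows "(\<integral>\<^sup>+w. g w * indicator ({u} \<times> {y} \<times> {j} \<times> A) w \<partial>slot_measure \<mu>)
    = (\<integral>\<^sup>+z. g (u, y, j, z) * indicator A z \<partial>option_measure \<mu>)"
proof -
  note [measurable] = assms(2,3)
  note s = sigma_finite_option_measure[OF assms(1)]
  note s2 = sigma_finite_pair_measure[OF sigma_finite_measure_count_space_countable s]
  note s3 = sigma_finite_pair_measure[OF sigma_finite_measure_count_space_countable s2]
  show ?thesis
    by (subst nn_integral_count_space_pair_singleton, (intro s3; simp), simp, measurable,
        subst nn_integral_count_space_pair_singleton, (intro s2; simp), measurable,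
        subst nn_integral_count_space_pair_singleton, rule s, measurable)
qed

section \<open>Record boxes as a determining class\<close>

definition record_box ::
    "nat \<Rightarrow> (nat \<Rightarrow> 'l option) \<Rightarrow> (nat \<Rightarrow> bool option) \<Rightarrow> (nat \<Rightarrow> nat option) \<Rightarrow> (nat \<Rightarrow> 'x option set)
      \<Rightarrow> (nat \<Rightarrow> 'l option \<times> bool option \<times> nat option \<times> 'x option) set" where
  "record_box n u y j A = (\<Pi>\<^sub>E k\<in>{1..n}. {u k} \<times> {y k} \<times> {j k} \<times> A k)"

lemma mem_record_box:
  "f \<in> record_box n u y j A \<longleftrightarrow>
    f \<in> extensional {1..n} \<and> (\<forall>k\<in>{1..n}. \<exists>z\<in>A k. f k = (u k, y k, j k, z))"
  unfolding record_box_def PiE_iff by auto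

lemma sets_record_box:
  assumes "\<And>k. k \<in> {1..n} \<Longrightarrow> A k \<in> sets (option_measure \<mu>)"
  shows "record_box n u y j A \<in> sets (obs_measure \<mu> n)"
  unfolding record_box_def obs_measure_def using assms by (intro sets_PiM_I_finite pair_measureI) auto

text \<open>The first three components of each slot take countably many values, so every measurable
  rectangle is a countable disjoint union of boxes on which they are constant. Countable additivity
  extends the agreement to rectangles, which determine a finite measure.\<close>

lemma obs_measure_eqI:
  fixes P Q :: "(nat \<Rightarrow> 'l::countable option \<times> bool option \<times> nat option \<times> 'x option) measure"
  assumes sets: "sets P = sets (obs_measure \<mu> n)" "sets Q = sets (obs_measure \<mu> n)"
    and fin: "finite_measure P"
    and eq: "\<And>u y j A. u \<in> extensional {1..n} \<Longrightarrow> y \<in> extensional {1..n} \<Longrightarrow> j \<in> extensional {1..n} \<Longrightarrow>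
      (\<And>k. k \<in> {1..n} \<Longrightarrow> A k \<in> sets (option_measure \<mu>)) \<Longrightarrow>
      emeasure P (record_box n u y j A) = emeasure Q (record_box n u y j A)"
  shows "P = Q"
proof -
  let ?K = "{1..n}" and ?M = "\<lambda>_::nat. slot_measure \<mu> :: ('l option \<times> _) measure"
  let ?V = "(?K \<rightarrow>\<^sub>E UNIV) \<times> (?K \<rightarrow>\<^sub>E UNIV) \<times> (?K \<rightarrow>\<^sub>E UNIV) ::
    ((nat \<Rightarrow> 'l option) \<times> (nat \<Rightarrow> bool option) \<times> (nat \<Rightarrow> nat option)) set"
  have cV: "countable ?V"
    by (intro countable_SIGMA countable_PiE) auto
  show ?thesis
  proof (rule measure_eqI_PiM_finite[where M = ?M and I = ?K and A = "\<lambda>_. space (Pi\<^sub>M ?K ?M)"])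
    fix A assume A: "\<And>i. i \<in> ?K \<Longrightarrow> A i \<in> sets (?M i)"
    \<comment> \<open>The section of side \<open>A k\<close> of the rectangle at the discrete values
      of slot \<open>k\<close>.\<close>
    define s where "s = (\<lambda>(u, y, j) k. {z. (u k :: 'l option, y k :: bool option, j k :: nat option, z) \<in> A k})"
    define X where "X = (\<lambda>v. record_box n (fst v) (fst (snd v)) (snd (snd v)) (s v))"
    have s: "s v k \<in> sets (option_measure \<mu>)" if "k \<in> ?K" for v k
    proof (cases v)
      case (fields u y j)
      have "Pair (j k) -` Pair (y k) -` Pair (u k) -` A k \<in> sets (option_measure \<mu>)"
        using A[OF that] by (intro sets_Pair1[where ?M1.0 = "count_space UNIV"])
      then show ?thesis
        by (simp add: s_def fields vimage_def)
    qed
    have un: "Pi\<^sub>E ?K A = (\<Union>v\<in>?V. X v)"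
    proof (intro set_eqI iffI)
      fix f assume f: "f \<in> Pi\<^sub>E ?K A"
      let ?v = "(\<lambda>k\<in>?K. fst (f k), \<lambda>k\<in>?K. fst (snd (f k)), \<lambda>k\<in>?K. fst (snd (snd (f k))))"
      have "\<exists>z\<in>s ?v k. f k = (fst (f k), fst (snd (f k)), fst (snd (snd (f k))), z)" if "k \<in> ?K" for k
        using PiE_mem[OF f that] that by (cases "f k") (simp add: s_def)
      then have "f \<in> X ?v"
        unfolding X_def mem_record_box using f by (simp add: PiE_iff)
      then show "f \<in> (\<Union>v\<in>?V. X v)"
        by (intro UN_I[of ?v]) auto
    next
      fix f assume "f \<in> (\<Union>v\<in>?V. X v)"
      then obtain u y j where f: "f \<in> X (u, y, j)"
        by auto
      have "f k \<in> A k" if k: "k \<in> ?K" for k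
      proof -
        obtain z where "z \<in> s (u, y, j) k" "f k = (u k, y k, j k, z)"
          using f k unfolding X_def mem_record_box fst_conv snd_conv by blast
        then show ?thesis
          by (simp add: s_def)
      qed
      with f show "f \<in> Pi\<^sub>E ?K A"
        by (simp add: X_def mem_record_box PiE_iff)
    qed
    \<comment> \<open>The extensional label of a box can be read off any of its points, so boxes
      with different labels are disjoint.\<close>
    have eV: "u = (\<lambda>k\<in>?K. fst (f k)) \<and> y = (\<lambda>k\<in>?K. fst (snd (f k))) \<and> j = (\<lambda>k\<in>?K. fst (snd (snd (f k))))"
      if "(u, y, j) \<in> ?V" "f \<in> X (u, y, j)" for u y j f
    proof -
      have f: "\<exists>z. f k = (u k, y k, j k, z)" if "k \<in> ?K" for k
        using \<open>f \<in> X _\<close> that unfolding X_def mem_record_box by auto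
      have e: "u \<in> extensional ?K" "y \<in> extensional ?K" "j \<in> extensional ?K"
        using that by (auto simp: PiE_iff)
      have "u k = fst (f k)" "y k = fst (snd (f k))" "j k = fst (snd (snd (f k)))" if "k \<in> ?K" for k
        using f[OF that] by auto
      with e show ?thesis
        by (intro conjI extensionalityI[where A = ?K]) auto
    qed
    have dis: "disjoint_family_on X ?V"
      unfolding disjoint_family_on_def
    proof (intro ballI impI)
      fix v w assume vw: "v \<in> ?V" "w \<in> ?V" "v \<noteq> w"
      show "X v \<inter> X w = {}"
      proof (rule ccontr)
        assume "X v \<inter> X w \<noteq> {}"
        then obtain f where "f \<in> X v" "f \<in> X w" by auto
        with eV[of "fst v" "fst (snd v)" "snd (snd v)" f] eV[of "fst w" "fst (snd w)" "snd (snd w)" f] vw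
        show False
          by (auto simp: prod_eq_iff)
      qed
    qed
    have sX: "X v \<in> sets (obs_measure \<mu> n)" for v
      unfolding X_def by (intro sets_record_box s)
    have "emeasure P (X v) = emeasure Q (X v)" if "v \<in> ?V" for v
      unfolding X_def using that by (intro eq s) (auto simp: PiE_iff)
    then show "emeasure P (Pi\<^sub>E ?K A) = emeasure Q (Pi\<^sub>E ?K A)"
      unfolding un using sX dis cV
      by (simp add: emeasure_UN_countable sets) (intro nn_integral_cong, simp)
  next
    show "range (\<lambda>_::nat. space (Pi\<^sub>M ?K ?M)) \<subseteq> prod_algebra ?K ?M"
      by (auto simp: space_PiM intro!: prod_algebraI_finite)
  qed (use sets fin in \<open>auto simp: obs_measure_def finite_measure.emeasure_finite\<close>)
qed

lemma sigma_finite_obs_measure: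
  assumes "sigma_finite_measure \<mu>"
  shows "sigma_finite_measure
    (obs_measure \<mu> n :: (nat \<Rightarrow> 'l::countable option \<times> bool option \<times> nat option \<times> 'x option) measure)"
proof -
  interpret product_sigma_finite "\<lambda>_::nat. slot_measure \<mu> :: ('l option \<times> _) measure"
    using sigma_finite_slot_measure[OF assms] by (simp add: product_sigma_finite_def)
  show ?thesis
    unfolding obs_measure_def by (rule sigma_finite) simp
qed

section \<open>Trajectories of the queues\<close>

text \<open>Two systems and two outcomes occur so that the same congruence lemmas serve two outcomes
  of one system and a system against its \<open>forced\<close> version. Agreement of the channels is
  assumed separately, and only in busy slots.\<close>

definition agree_upto ::
    "nat \<Rightarrow> ('w, 'l, 'x) sensor_system \<Rightarrow> 'w \<Rightarrow> ('w, 'l, 'x) sensor_system \<Rightarrow> 'w \<Rightarrow> bool" where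
  "agree_upto m S \<omega> T \<omega>' \<longleftrightarrow>
     init_queue S \<omega> = init_queue T \<omega>' \<and>
     (\<forall>k\<in>{1..m}. \<forall>l. sampled S k l \<omega> = sampled T k l \<omega>') \<and>
     (\<forall>k\<in>{1..m}. \<forall>N. N \<noteq> {} \<longrightarrow> pick S k N \<omega> = pick T k N \<omega>')"

lemma norm0_pos_iff: "0 < norm0 q \<longleftrightarrow> support q \<noteq> {}" for q :: "'l::finite \<Rightarrow> nat"
  by (simp add: norm0_def card_gt_0_iff)

text \<open>The queue at the start of slot \<open>k\<close> uses only slots before \<open>k\<close>,
  which allows \<open>k = Suc m\<close>; channel and pick act only in busy slots.\<close>

lemma queue_cong:
  fixes S T :: "('w, 'l::finite, 'x) sensor_system"
  assumes "agree_upto m S \<omega> T \<omega>'"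
    and "\<And>i. 1 \<le> i \<Longrightarrow> i < k \<Longrightarrow> 0 < norm0 (queue S i \<omega>) \<Longrightarrow> channel S i \<omega> = channel T i \<omega>'"
    and "k \<le> Suc m"
  shows "queue S k \<omega> = queue T k \<omega>'"
  using assms(2,3)
proof (induction k rule: less_induct)
  case (less k)
  consider "k = 0" | "k = Suc 0" | i where "k = Suc (Suc i)"
    by (metis not0_implies_Suc)
  then show ?case
  proof cases
    case 3
    let ?q = "queue S (Suc i) \<omega>"
    have q: "queue T (Suc i) \<omega>' = ?q"
      using less 3 by auto
    have "sampled S (Suc i) l \<omega> = sampled T (Suc i) l \<omega>'" for l
      using assms(1) less.prems 3 by (auto simp: agree_upto_def)
    moreover have "0 < norm0 ?q \<and> channel S (Suc i) \<omega> \<and> pick S (Suc i) (support ?q) \<omega> = l \<longleftrightarrow>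
      0 < norm0 ?q \<and> channel T (Suc i) \<omega>' \<and> pick T (Suc i) (support ?q) \<omega>' = l" for l
    proof (cases "0 < norm0 ?q")
      case True
      then have "channel S (Suc i) \<omega> = channel T (Suc i) \<omega>'"
        using less.prems 3 by auto
      moreover have "pick S (Suc i) (support ?q) \<omega> = pick T (Suc i) (support ?q) \<omega>'"
        using assms(1) less.prems 3 True by (auto simp: agree_upto_def norm0_pos_iff)
      ultimately show ?thesis
        by simp
    qed simp
    ultimately show ?thesis
      by (simp add: 3 q Let_def)
  qed (use assms(1) in \<open>auto simp: agree_upto_def\<close>)
qed

lemma obs_cong:
  fixes S T :: "('w, 'l::finite, 'x) sensor_system"
  assumes "agree_upto m S \<omega> T \<omega>'"
    and ch: "\<And>i. 1 \<le> i \<Longrightarrow> i \<le> k \<Longrightarrow> 0 < norm0 (queue S i \<omega>) \<Longrightarrow> channel S i \<omega> = channel T i \<omega>'"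
    and "1 \<le> k" "k \<le> m"
  shows "obs_Y S k \<omega> = obs_Y T k \<omega>'" "obs_U S k \<omega> = obs_U T k \<omega>'" "obs_J S k \<omega> = obs_J T k \<omega>'"
proof -
  have q: "queue S i \<omega> = queue T i \<omega>'" if "i \<le> k" for i
    using that assms by (intro queue_cong[OF assms(1)]) auto
  have Y: "obs_Y S i \<omega> = obs_Y T i \<omega>'" if "1 \<le> i" "i \<le> k" for i
    using q[OF that(2)] ch[OF that] by (auto simp: obs_Y_def)
  have U: "obs_U S i \<omega> = obs_U T i \<omega>'" if "1 \<le> i" "i \<le> k" for i
  proof -
    have "obs_Y T i \<omega>' = Some True \<Longrightarrow> support (queue T i \<omega>') \<noteq> {}"
      by (auto simp: obs_Y_def norm0_pos_iff split: if_splits)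
    then show ?thesis
      using Y[OF that] q[OF that(2)] that assms(1,4) by (auto simp: obs_U_def agree_upto_def)
  qed
  show "obs_Y S k \<omega> = obs_Y T k \<omega>'" "obs_U S k \<omega> = obs_U T k \<omega>'"
    using Y U assms(3) by auto
  have "{i \<in> {1..k}. obs_U S i \<omega> = Some l} = {i \<in> {1..k}. obs_U T i \<omega>' = Some l}" for l
    using U by auto
  then show "obs_J S k \<omega> = obs_J T k \<omega>'"
    using U assms(3) by (simp add: obs_J_def)
qed

lemma arrivals_cong:
  assumes "agree_upto m S \<omega> T \<omega>'" "n \<le> m"
  shows "arrivals S n \<omega> = arrivals T n \<omega>'"
proof
  fix l
  have "{k \<in> {1..n}. sampled S k l \<omega>} = {k \<in> {1..n}. sampled T k l \<omega>'}"
    using assms by (auto simp: agree_upto_def)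
  then show "arrivals S n \<omega> l = arrivals T n \<omega>' l"
    by (simp add: arrivals_def)
qed

lemma arrivals_0 [simp]: "arrivals S 0 \<omega> l = 0"
  by (simp add: arrivals_def)

lemma arrivals_Suc: "arrivals S (Suc n) \<omega> l = arrivals S n \<omega> l + of_bool (sampled S (Suc n) l \<omega>)"
proof -
  have "{k \<in> {1..Suc n}. sampled S k l \<omega>} =
    {k \<in> {1..n}. sampled S k l \<omega>} \<union> (if sampled S (Suc n) l \<omega> then {Suc n} else {})"
    by (auto simp: le_Suc_eq)
  then show ?thesis
    by (simp add: arrivals_def)
qed

lemma arrivals_mono: "m \<le> n \<Longrightarrow> arrivals S m \<omega> l \<le> arrivals S n \<omega> l"
  unfolding arrivals_def by (intro card_mono) auto

text \<open>\<open>None\<close> is read as failure. Where the forced record agrees with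
  \<open>y\<close>, such a slot is idle and this value has no effect.\<close>

definition forced :: "('w, 'l, 'x) sensor_system \<Rightarrow> (nat \<Rightarrow> bool option) \<Rightarrow> ('w, 'l, 'x) sensor_system"
  where "forced S y = S\<lparr>channel := \<lambda>k _. y k = Some True\<rparr>"

lemma forced_simps [simp]:
  "init_queue (forced S y) = init_queue S" "sampled (forced S y) = sampled S"
  "reading (forced S y) = reading S" "init_reading (forced S y) = init_reading S"
  "channel (forced S y) = (\<lambda>k _. y k = Some True)" "pick (forced S y) = pick S"
  by (simp_all add: forced_def)

lemma agree_upto_forced:
  "agree_upto m (forced S y) \<omega> T \<omega>' = agree_upto m S \<omega> T \<omega>'"
  "agree_upto m S \<omega> (forced T y) \<omega>' = agree_upto m S \<omega> T \<omega>'"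
  by (simp_all add: agree_upto_def)

lemma agree_upto_refl [simp]: "agree_upto m S \<omega> S \<omega>"
  by (simp add: agree_upto_def)

text \<open>Either side makes the real and the prescribed channel agree in busy slots, since
  \<open>y\<close> is then the observed outcome; so both systems evolve alike. Slots with
  \<open>y k = None\<close> are idle, hence absent from the channel condition.\<close>

lemma observed_iff_forced:
  fixes S :: "('w, 'l::finite, 'x) sensor_system"
  shows "(\<forall>k\<in>{1..n}. obs_U S k \<omega> = u k \<and> obs_Y S k \<omega> = y k \<and> obs_J S k \<omega> = j k) \<longleftrightarrow>
    (\<forall>k\<in>{1..n}. obs_U (forced S y) k \<omega> = u k \<and> obs_Y (forced S y) k \<omega> = y k \<and>
      obs_J (forced S y) k \<omega> = j k) \<and>
    (\<forall>k\<in>{1..n}. y k \<noteq> None \<longrightarrow> channel S k \<omega> = (y k = Some True))"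
    (is "?L \<longleftrightarrow> ?R \<and> ?C")
proof -
  have ag: "agree_upto n S \<omega> (forced S y) \<omega>" "agree_upto n (forced S y) \<omega> S \<omega>"
    by (simp_all add: agree_upto_forced)
  have C: ?C if ?L
    using that by (auto simp: obs_Y_def split: if_splits)
  have "obs_U S k \<omega> = obs_U (forced S y) k \<omega> \<and> obs_Y S k \<omega> = obs_Y (forced S y) k \<omega> \<and>
    obs_J S k \<omega> = obs_J (forced S y) k \<omega>" if L: ?L and k: "k \<in> {1..n}" for k
  proof -
    have ch: "channel S i \<omega> = channel (forced S y) i \<omega>"
      if "1 \<le> i" "i \<le> k" "0 < norm0 (queue S i \<omega>)" for i
    proof -
      have "obs_Y S i \<omega> = y i"
        using L that k by auto
      then show ?thesis
        using that by (auto simp: obs_Y_def)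
    qed
    show ?thesis
      using obs_cong[OF ag(1) ch, of k] k by auto
  qed
  moreover have "obs_U (forced S y) k \<omega> = obs_U S k \<omega> \<and> obs_Y (forced S y) k \<omega> = obs_Y S k \<omega> \<and>
    obs_J (forced S y) k \<omega> = obs_J S k \<omega>" if R: ?R ?C and k: "k \<in> {1..n}" for k
  proof -
    have ch: "channel (forced S y) i \<omega> = channel S i \<omega>"
      if "1 \<le> i" "i \<le> k" "0 < norm0 (queue (forced S y) i \<omega>)" for i
    proof -
      have i: "i \<in> {1..n}"
        using that k by auto
      then have "obs_Y (forced S y) i \<omega> = y i"
        using R(1) by blast
      then have "y i \<noteq> None"
        using that by (cases "y i") (auto simp: obs_Y_def)
      then show ?thesis
        using R(2) i by simp
    qed
    show ?thesis
      using obs_cong[OF ag(2) ch, of k] k by auto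
  qed
  ultimately show ?thesis
    using C by metis
qed

section \<open>Deliveries, packet indices and sampling slots\<close>

definition delivered :: "('w, 'l, 'x) sensor_system \<Rightarrow> nat \<Rightarrow> 'w \<Rightarrow> 'l \<Rightarrow> nat" where
  "delivered S k \<omega> l = card {i \<in> {1..k}. obs_U S i \<omega> = Some l}"

lemma delivered_0 [simp]: "delivered S 0 \<omega> l = 0"
  by (simp add: delivered_def)

lemma delivered_Suc:
  "delivered S (Suc n) \<omega> l = delivered S n \<omega> l + of_bool (obs_U S (Suc n) \<omega> = Some l)"
proof -
  have "{k \<in> {1..Suc n}. obs_U S k \<omega> = Some l} =
    {k \<in> {1..n}. obs_U S k \<omega> = Some l} \<union> (if obs_U S (Suc n) \<omega> = Some l then {Suc n} else {})"
    by (auto simp: le_Suc_eq)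
  then show ?thesis
    by (simp add: delivered_def)
qed

lemma delivered_mono: "m \<le> n \<Longrightarrow> delivered S m \<omega> l \<le> delivered S n \<omega> l"
  unfolding delivered_def by (intro card_mono) auto

lemma obs_U_eq_SomeD: "obs_U S k \<omega> = Some l \<Longrightarrow> obs_Y S k \<omega> = Some True"
  by (simp add: obs_U_def split: if_splits)

lemma obs_U_eq_Some_iff:
  "obs_U S k \<omega> = Some l \<longleftrightarrow>
    0 < norm0 (queue S k \<omega>) \<and> channel S k \<omega> \<and> pick S k (support (queue S k \<omega>)) \<omega> = l"
  by (auto simp: obs_U_def obs_Y_def)

lemma obs_J_eq: "obs_J S k \<omega> = map_option (delivered S k \<omega>) (obs_U S k \<omega>)"
  by (cases "obs_U S k \<omega>") (simp_all add: obs_J_def delivered_def)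

lemma queue_pos_of_delivery:
  fixes S :: "('w, 'l::finite, 'x) sensor_system"
  assumes "\<And>k N. 1 \<le> k \<Longrightarrow> N \<noteq> {} \<Longrightarrow> pick S k N \<omega> \<in> N"
    and "1 \<le> k" "obs_U S k \<omega> = Some l"
  shows "0 < queue S k \<omega> l"
proof -
  have "support (queue S k \<omega>) \<noteq> {}" "pick S k (support (queue S k \<omega>)) \<omega> = l"
    using assms(3) by (auto simp: obs_U_eq_Some_iff norm0_pos_iff)
  then have "l \<in> support (queue S k \<omega>)"
    using assms(1)[OF assms(2)] by metis
  then show ?thesis
    by (simp add: support_def)
qed

text \<open>Conservation of packets. A delivering queue is non-empty, so the truncated subtraction
  in \<open>queue\<close> loses nothing.\<close>

lemma delivered_plus_queue:
  fixes S :: "('w, 'l::finite, 'x) sensor_system"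
  assumes pick: "\<And>k N. 1 \<le> k \<Longrightarrow> N \<noteq> {} \<Longrightarrow> pick S k N \<omega> \<in> N"
  shows "delivered S k \<omega> l + queue S (Suc k) \<omega> l = init_queue S \<omega> l + arrivals S k \<omega> l"
proof (induction k)
  case (Suc k)
  have "0 < queue S (Suc k) \<omega> l" if "obs_U S (Suc k) \<omega> = Some l"
    using queue_pos_of_delivery[OF pick _ that] by simp
  with Suc show ?case
    by (auto simp: delivered_Suc arrivals_Suc Let_def obs_U_eq_Some_iff)
qed simp

text \<open>A packet delivered in slot \<open>k\<close> was queued at the start of that slot, hence
  arrived by slot \<open>k - 1\<close>; conservation turns this into the bound.\<close>

lemma delivered_bounds:
  fixes S :: "('w, 'l::finite, 'x) sensor_system"
  assumes pick: "\<And>k N. 1 \<le> k \<Longrightarrow> N \<noteq> {} \<Longrightarrow> pick S k N \<omega> \<in> N"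
    and "1 \<le> k" "obs_U S k \<omega> = Some l"
  shows "1 \<le> delivered S k \<omega> l" "delivered S k \<omega> l \<le> init_queue S \<omega> l + arrivals S (k - 1) \<omega> l"
proof -
  obtain i where i: "k = Suc i"
    using assms(2) by (cases k) auto
  show "1 \<le> delivered S k \<omega> l"
    using assms(3) by (simp add: i delivered_Suc)
  show "delivered S k \<omega> l \<le> init_queue S \<omega> l + arrivals S (k - 1) \<omega> l"
    using queue_pos_of_delivery[OF pick assms(2,3)] delivered_plus_queue[OF pick, of i l] assms(3)
    by (simp add: i delivered_Suc)
qed

text \<open>The count of a sensor increases strictly at each of its deliveries, so no index is used
  twice.\<close>

lemma delivered_inj:
  assumes "obs_U S k \<omega> = Some l" "obs_U S k' \<omega> = Some l" "1 \<le> k" "1 \<le> k'"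
    and "delivered S k \<omega> l = delivered S k' \<omega> l"
  shows "k = k'"
proof -
  have *: "delivered S i \<omega> l < delivered S i' \<omega> l" if "i < i'" "obs_U S i' \<omega> = Some l" for i i'
  proof -
    obtain i'' where "i' = Suc i''" "i \<le> i''"
      using \<open>i < i'\<close> by (cases i') auto
    then show ?thesis
      using that(2) delivered_mono[of i i'' S \<omega> l] by (simp add: delivered_Suc)
  qed
  show ?thesis
    using *[of k k'] *[of k' k] assms by (cases k k' rule: linorder_cases) auto
qed

text \<open>The case distinction of \<open>packet\<close>, returning the name of the random variable
  instead of its value, so that independence can be applied although the sampling slot is
  random.\<close>

definition packet_source :: "('w, 'l, 'x) sensor_system \<Rightarrow> nat \<Rightarrow> 'l \<Rightarrow> 'w \<Rightarrow> 'l source" where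
  "packet_source S j l \<omega> =
     (if j \<le> init_queue S \<omega> l then InitReading j l
      else Reading (LEAST k. j \<le> init_queue S \<omega> l + arrivals S k \<omega> l) l)"

fun source_reading :: "('w, 'l, 'x) sensor_system \<Rightarrow> 'l source \<Rightarrow> 'w \<Rightarrow> 'x" where
  "source_reading S (InitReading j l) = init_reading S j l"
| "source_reading S (Reading k l) = reading S k l"
| "source_reading S _ = undefined"

lemma packet_eq_source_reading: "packet S j l \<omega> = source_reading S (packet_source S j l \<omega>) \<omega>"
  by (simp add: packet_def packet_source_def)

text \<open>Cumulative arrivals start at 0 and grow by at most one per slot, so the first slot where
  they suffice for packet \<open>j\<close> hits its index exactly. The bound at \<open>m\<close>
  makes such a slot exist. The last equivalence produces the index condition of the likelihood ratio
  from the position of the sampling slot.\<close>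

lemma sampling_slot:
  fixes S :: "('w, 'l, 'x) sensor_system"
  assumes "init_queue S \<omega> l < j" "j \<le> init_queue S \<omega> l + arrivals S m \<omega> l"
  defines "t \<equiv> LEAST k. j \<le> init_queue S \<omega> l + arrivals S k \<omega> l"
  shows "1 \<le> t" "t \<le> m" "j = init_queue S \<omega> l + arrivals S t \<omega> l"
    "t \<le> c \<longleftrightarrow> j \<le> init_queue S \<omega> l + arrivals S c \<omega> l"
proof -
  have P: "j \<le> init_queue S \<omega> l + arrivals S t \<omega> l"
    unfolding t_def by (rule LeastI) (rule assms(2))
  show "1 \<le> t"
  proof (rule ccontr)
    assume "\<not> 1 \<le> t"
    then show False
      using P assms(1) by (cases t) auto
  qed
  then obtain t' where t': "t = Suc t'"
    by (cases t) auto
  then have "\<not> j \<le> init_queue S \<omega> l + arrivals S t' \<omega> l"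
    using not_less_Least[of t' "\<lambda>k. j \<le> init_queue S \<omega> l + arrivals S k \<omega> l"] by (simp add: t_def)
  with P show "j = init_queue S \<omega> l + arrivals S t \<omega> l"
    by (cases "sampled S (Suc t') l \<omega>") (auto simp: t' arrivals_Suc)
  show "t \<le> m"
    unfolding t_def by (rule Least_le) (rule assms(2))
  show "t \<le> c \<longleftrightarrow> j \<le> init_queue S \<omega> l + arrivals S c \<omega> l"
  proof
    assume "t \<le> c"
    from arrivals_mono[OF this, of S \<omega> l] P
    show "j \<le> init_queue S \<omega> l + arrivals S c \<omega> l"
      by simp
  qed (auto simp: t_def intro: Least_le)
qed

text \<open>An initial packet carries its index in the name; for a later one the index is recovered
  from the cumulative arrivals at its sampling slot.\<close>

lemma packet_source_inj:
  assumes "packet_source S j l \<omega> = packet_source S j' l' \<omega>"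
    and "j \<le> init_queue S \<omega> l + arrivals S m \<omega> l" "j' \<le> init_queue S \<omega> l' + arrivals S m \<omega> l'"
  shows "j = j' \<and> l = l'"
  using assms sampling_slot(3)[of S \<omega> l j m] sampling_slot(3)[of S \<omega> l' j' m]
  by (auto simp: packet_source_def not_le split: if_splits)

text \<open>The least slot is at most \<open>m\<close>, so the witness and its minimality involve
  only arrivals up to \<open>m\<close>.\<close>

lemma packet_source_cong:
  assumes "agree_upto m S \<omega> S \<omega>'" "j \<le> init_queue S \<omega> l + arrivals S m \<omega> l"
  shows "packet_source S j l \<omega> = packet_source S j l \<omega>'"
proof (cases "j \<le> init_queue S \<omega> l")
  case True
  then show ?thesis
    using assms by (simp add: packet_source_def agree_upto_def)
next
  case False
  have init: "init_queue S \<omega> = init_queue S \<omega>'"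
    using assms by (simp add: agree_upto_def)
  have arr: "arrivals S k \<omega> = arrivals S k \<omega>'" if "k \<le> m" for k
    using arrivals_cong[OF assms(1) that] .
  let ?P = "\<lambda>\<omega> k. j \<le> init_queue S \<omega> l + arrivals S k \<omega> l"
  let ?t = "LEAST k. ?P \<omega> k"
  have t: "?t \<le> m" "?P \<omega> ?t"
    using assms(2) by (auto intro: Least_le LeastI)
  have "(LEAST k. ?P \<omega>' k) = ?t"
  proof (rule Least_equality)
    show "?P \<omega>' ?t"
      using t arr[OF t(1)] init by simp
    fix k assume k: "?P \<omega>' k"
    show "?t \<le> k"
    proof (cases "k \<le> m")
      case True
      then show ?thesis
        using k arr init by (intro Least_le) simp
    next
      case False
      then show ?thesis
        using t by simp
    qed
  qed
  then show ?thesis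
    using False init by (simp add: packet_source_def)
qed

section \<open>Independent sources\<close>

text \<open>One countable type for the values of all discrete sources; readings get a dummy value.\<close>

fun source_val :: "('w, 'l, 'x) sensor_system \<Rightarrow> 'l source \<Rightarrow> 'w \<Rightarrow> ('l \<Rightarrow> nat) + bool + 'l" where
  "source_val S Init \<omega> = Inl (init_queue S \<omega>)"
| "source_val S (Sampled k l) \<omega> = Inr (Inl (sampled S k l \<omega>))"
| "source_val S (Channel k) \<omega> = Inr (Inl (channel S k \<omega>))"
| "source_val S (Pick k N) \<omega> = Inr (Inr (pick S k N \<omega>))"
| "source_val S _ \<omega> = Inr (Inl False)"

fun is_reading :: "'l source \<Rightarrow> bool" where
  "is_reading (Reading k l) = True"
| "is_reading (InitReading j l) = True"
| "is_reading _ = False"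

text \<open>The sources that drive the queues up to slot \<open>m\<close>, other than the channel. Their laws do
  not depend on the change point.\<close>

definition base_sources :: "nat \<Rightarrow> 'l source set" where
  "base_sources m =
     insert Init ((\<lambda>(k, l). Sampled k l) ` ({1..m} \<times> UNIV) \<union> (\<lambda>(k, N). Pick k N) ` ({1..m} \<times> {N. N \<noteq> {}}))"

lemma finite_base_sources: "finite (base_sources m :: 'l::finite source set)"
  by (simp add: base_sources_def)

lemma base_sources_subset: "base_sources m \<subseteq> sources - {s. is_reading s} - range Channel"
  by (auto simp: base_sources_def sources_def)

lemma agree_upto_iff_source_val:
  "agree_upto m S \<omega> S \<omega>' \<longleftrightarrow> (\<forall>s\<in>base_sources m. source_val S s \<omega> = source_val S s \<omega>')"
  by (auto simp: agree_upto_def base_sources_def ball_Un)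

context sensor_law
begin

lemma sets_source_events_reading:
  assumes "s \<in> sources" "is_reading s" "A \<in> sets \<mu>"
  shows "{\<omega> \<in> space M. source_reading S s \<omega> \<in> A} \<in> source_events M \<mu> S s"
proof -
  have "source_reading S s \<in> space M \<rightarrow> space \<mu>"
    using assms reading_law init_reading_law
    by (cases s) (auto simp: sources_def dest!: distributed_measurable measurable_space)
  then have "sets (vimage_algebra (space M) (source_reading S s) \<mu>) =
    {source_reading S s -` A \<inter> space M | A. A \<in> sets \<mu>}"
    by (rule sets_vimage_algebra2)
  moreover have "source_events M \<mu> S s = sets (vimage_algebra (space M) (source_reading S s) \<mu>)"
    using assms by (cases s) auto
  moreover have "{\<omega> \<in> space M. source_reading S s \<omega> \<in> A} = source_reading S s -` A \<inter> space M"
    by auto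
  ultimately show ?thesis
    using assms(3) by blast
qed

lemma source_val_event:
  assumes "\<not> is_reading s"
  shows "{\<omega> \<in> space M. source_val S s \<omega> = v} \<in> source_events M \<mu> S s"
proof -
  have *: "{\<omega> \<in> space M. g (f \<omega>) = v} \<in> sets (vimage_algebra (space M) f (count_space UNIV))"
    for f :: "'w \<Rightarrow> 'a" and g :: "'a \<Rightarrow> ('l \<Rightarrow> nat) + bool + 'l"
  proof -
    have "{\<omega> \<in> space M. g (f \<omega>) = v} = f -` {x. g x = v} \<inter> space M"
      by auto
    then show ?thesis
      by (subst sets_vimage_algebra2) (auto intro!: exI[of _ "{x. g x = v}"])
  qed
  show ?thesis
    using assms *[of Inl "init_queue S"] *[of "\<lambda>b. Inr (Inl b)"] *[of "\<lambda>b. Inr (Inr b)"]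
    by (cases s) auto
qed

lemma source_events_subset: "s \<in> sources \<Longrightarrow> source_events M \<mu> S s \<subseteq> events"
  using independent by (auto simp: indep_sets_def)

lemma emeasure_indep_sources:
  assumes "finite J" "J \<subseteq> sources"
    and "\<And>s. s \<in> J \<Longrightarrow> {\<omega> \<in> space M. P s \<omega>} \<in> source_events M \<mu> S s"
  shows "{\<omega> \<in> space M. \<forall>s\<in>J. P s \<omega>} \<in> events"
    and "emeasure M {\<omega> \<in> space M. \<forall>s\<in>J. P s \<omega>} = (\<Prod>s\<in>J. emeasure M {\<omega> \<in> space M. P s \<omega>})"
proof -
  have ev: "{\<omega> \<in> space M. P s \<omega>} \<in> events" if "s \<in> J" for s
    using assms(2,3) that source_events_subset by blast
  then show "{\<omega> \<in> space M. \<forall>s\<in>J. P s \<omega>} \<in> events"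
    using assms(1) by (intro sets.sets_Collect_finite_All) auto
  show "emeasure M {\<omega> \<in> space M. \<forall>s\<in>J. P s \<omega>} = (\<Prod>s\<in>J. emeasure M {\<omega> \<in> space M. P s \<omega>})"
  \<comment> \<open>\<open>indep_setsD\<close> asks for a non-empty index set; for the empty one
    both sides are 1.\<close>
  proof (cases "J = {}")
    case False
    then have eq: "{\<omega> \<in> space M. \<forall>s\<in>J. P s \<omega>} = (\<Inter>s\<in>J. {\<omega> \<in> space M. P s \<omega>})"
      by auto
    have "prob (\<Inter>s\<in>J. {\<omega> \<in> space M. P s \<omega>}) = (\<Prod>s\<in>J. prob {\<omega> \<in> space M. P s \<omega>})"
      by (rule indep_setsD[OF independent assms(2) False assms(1)]) (use assms(3) in auto)
    then show ?thesis
      unfolding eq by (simp add: emeasure_eq_measure prod_ennreal)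
  qed (simp add: emeasure_space_1)
qed

text \<open>Summation over the countably many atoms of the discrete sources \<open>I\<close>; the independent
  event may differ from atom to atom as long as its probability does not.\<close>

lemma emeasure_saturated:
  assumes I: "finite I" "I \<subseteq> sources" "\<And>s. s \<in> I \<Longrightarrow> \<not> is_reading s"
    and E: "E \<subseteq> space M"
    and sat: "\<And>\<omega> \<omega>'. \<omega> \<in> E \<Longrightarrow> \<omega>' \<in> space M \<Longrightarrow>
      (\<forall>s\<in>I. source_val S s \<omega> = source_val S s \<omega>') \<Longrightarrow> \<omega>' \<in> E"
    and indep: "\<And>\<omega>0. \<omega>0 \<in> E \<Longrightarrow> \<exists>J P. finite J \<and> J \<subseteq> sources - I \<and>
      (\<forall>s\<in>J. {\<omega> \<in> space M. P s \<omega>} \<in> source_events M \<mu> S s) \<and>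
      (\<forall>\<omega>\<in>space M. (\<forall>s\<in>I. source_val S s \<omega>0 = source_val S s \<omega>) \<longrightarrow> (Q \<omega> \<longleftrightarrow> (\<forall>s\<in>J. P s \<omega>))) \<and>
      (\<Prod>s\<in>J. emeasure M {\<omega> \<in> space M. P s \<omega>}) = \<kappa>"
  shows "{\<omega> \<in> E. Q \<omega>} \<in> events" "E \<in> events"
    "emeasure M {\<omega> \<in> E. Q \<omega>} = emeasure M E * \<kappa>"
    "emeasure M E = (\<integral>\<^sup>+w. (\<Prod>s\<in>I. emeasure M {\<omega> \<in> space M. source_val S s \<omega> = w s})
      \<partial>count_space ((\<lambda>\<omega>. \<lambda>s\<in>I. source_val S s \<omega>) ` E))"
proof -
  \<comment> \<open>\<open>W \<omega>\<close> labels the atom of \<open>\<omega>\<close>. Values lie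
    in a countable type and \<open>I\<close> is finite, so there are countably many labels.\<close>
  define W where "W \<omega> = (\<lambda>s\<in>I. source_val S s \<omega>)" for \<omega>
  have W: "W \<omega> = W \<omega>' \<longleftrightarrow> (\<forall>s\<in>I. source_val S s \<omega> = source_val S s \<omega>')" for \<omega> \<omega>'
    by (auto simp: W_def restrict_def fun_eq_iff)
  have "countable (I \<rightarrow>\<^sub>E (UNIV :: (('l \<Rightarrow> nat) + bool + 'l) set))"
    by (intro countable_PiE I) auto
  then have cnt: "countable (W ` E)"
    by (rule countable_subset[rotated]) (auto simp: W_def)
  define X where "X w = {\<omega> \<in> space M. W \<omega> = w}" for w
  have ev: "\<forall>s\<in>I. {\<omega> \<in> space M. source_val S s \<omega> = v s} \<in> source_events M \<mu> S s" for v
    using I(3) source_val_event by blast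
  have X: "X (W \<omega>0) = {\<omega> \<in> space M. \<forall>s\<in>I. source_val S s \<omega> = W \<omega>0 s}" for \<omega>0
    unfolding X_def W by (auto simp: W_def)
  have XE: "X w \<in> events"
    and XP: "emeasure M (X w) = (\<Prod>s\<in>I. emeasure M {\<omega> \<in> space M. source_val S s \<omega> = w s})"
    if "w \<in> W ` E" for w
    using that emeasure_indep_sources[OF I(1,2), of "\<lambda>s \<omega>. source_val S s \<omega> = w s"] ev[of w] X
    by auto
  have dis: "disjoint_family_on (\<lambda>w. X w \<inter> B) (W ` E)" for B
    by (auto simp: disjoint_family_on_def X_def)
  \<comment> \<open>Intersecting with \<open>UNIV\<close> gives this decomposition the shape of the
    next one, so that \<open>dis\<close> covers both.\<close>
  have EX: "E = (\<Union>w\<in>W ` E. X w \<inter> UNIV)"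
    using sat E by (auto simp: X_def W)
  have EQ: "{\<omega> \<in> E. Q \<omega>} = (\<Union>w\<in>W ` E. X w \<inter> {\<omega>. Q \<omega>})"
    using sat E by (auto simp: X_def W)
  have XQ: "X w \<inter> {\<omega>. Q \<omega>} \<in> events" "emeasure M (X w \<inter> {\<omega>. Q \<omega>}) = emeasure M (X w) * \<kappa>"
    if w: "w \<in> W ` E" for w
  proof -
    obtain \<omega>0 where \<omega>0: "\<omega>0 \<in> E" "w = W \<omega>0"
      using w by auto
    from indep[OF \<omega>0(1)] obtain J P where
      "finite J \<and> J \<subseteq> sources - I \<and>
      (\<forall>s\<in>J. {\<omega> \<in> space M. P s \<omega>} \<in> source_events M \<mu> S s) \<and>
      (\<forall>\<omega>\<in>space M. (\<forall>s\<in>I. source_val S s \<omega>0 = source_val S s \<omega>) \<longrightarrow> (Q \<omega> \<longleftrightarrow> (\<forall>s\<in>J. P s \<omega>))) \<and>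
      (\<Prod>s\<in>J. emeasure M {\<omega> \<in> space M. P s \<omega>}) = \<kappa>"
      by (elim exE)
    then have J: "finite J" "J \<subseteq> sources - I"
      "\<And>s. s \<in> J \<Longrightarrow> {\<omega> \<in> space M. P s \<omega>} \<in> source_events M \<mu> S s"
      "\<And>\<omega>. \<omega> \<in> space M \<Longrightarrow> (\<forall>s\<in>I. source_val S s \<omega>0 = source_val S s \<omega>) \<Longrightarrow> Q \<omega> \<longleftrightarrow> (\<forall>s\<in>J. P s \<omega>)"
      "(\<Prod>s\<in>J. emeasure M {\<omega> \<in> space M. P s \<omega>}) = \<kappa>"
      by blast+
    \<comment> \<open>One family of conditions on \<open>I \<union> J\<close>, so that a single use
      of independence separates the atom from the event of \<open>J\<close>.\<close>
    define R where "R s \<omega> = (if s \<in> I then source_val S s \<omega> = w s else P s \<omega>)" for s \<omega>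
    have JI: "s \<notin> I" if "s \<in> J" for s
      using J(2) that by auto
    have JS: "J \<subseteq> sources"
      using J(2) by auto
    have wv: "w s = source_val S s \<omega>0" if "s \<in> I" for s
      using that by (simp add: \<omega>0(2) W_def)
    have all: "(\<forall>s\<in>I \<union> J. R s \<omega>) \<longleftrightarrow> (\<forall>s\<in>I. source_val S s \<omega>0 = source_val S s \<omega>) \<and> (\<forall>s\<in>J. P s \<omega>)"
      for \<omega>
      using JI wv by (simp add: R_def ball_Un eq_commute)
    have "X w \<inter> {\<omega>. Q \<omega>} = {\<omega> \<in> space M. \<forall>s\<in>I \<union> J. R s \<omega>}"
      unfolding all X_def \<omega>0(2) W using J(4) by (auto simp: eq_commute)
    moreover have R: "{\<omega> \<in> space M. R s \<omega>} \<in> source_events M \<mu> S s" if "s \<in> I \<union> J" for s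
      using that J(2,3) ev[of w] by (auto simp: R_def)
    moreover have "(\<Prod>s\<in>I \<union> J. emeasure M {\<omega> \<in> space M. R s \<omega>}) = emeasure M (X w) * \<kappa>"
    proof -
      have "(\<Prod>s\<in>I \<union> J. emeasure M {\<omega> \<in> space M. R s \<omega>}) =
        (\<Prod>s\<in>I. emeasure M {\<omega> \<in> space M. R s \<omega>}) * (\<Prod>s\<in>J. emeasure M {\<omega> \<in> space M. R s \<omega>})"
        using I(1) J(1,2) by (intro prod.union_disjoint) auto
      also have "(\<Prod>s\<in>I. emeasure M {\<omega> \<in> space M. R s \<omega>}) = emeasure M (X w)"
        unfolding XP[OF w] by (intro prod.cong) (auto simp: R_def)
      also have "(\<Prod>s\<in>J. emeasure M {\<omega> \<in> space M. R s \<omega>}) = \<kappa>"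
        unfolding J(5)[symmetric] using J(2)
        by (intro prod.cong refl arg_cong[where f = "emeasure M"]) (auto simp: R_def)
      finally show ?thesis .
    qed
    ultimately show "X w \<inter> {\<omega>. Q \<omega>} \<in> events"
      "emeasure M (X w \<inter> {\<omega>. Q \<omega>}) = emeasure M (X w) * \<kappa>"
      using emeasure_indep_sources[of "I \<union> J" R] I J(1) JS by auto
  qed
  show "{\<omega> \<in> E. Q \<omega>} \<in> events"
    unfolding EQ using cnt XQ by (intro sets.countable_UN') auto
  show "E \<in> events"
    by (subst EX, intro sets.countable_UN') (use cnt XE in auto)
  have E_sum: "emeasure M E = (\<integral>\<^sup>+w. emeasure M (X w) \<partial>count_space (W ` E))"
    by (subst EX, subst emeasure_UN_countable) (use cnt XE dis[of UNIV] in auto)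
  then show "emeasure M E = (\<integral>\<^sup>+w. (\<Prod>s\<in>I. emeasure M {\<omega> \<in> space M. source_val S s \<omega> = w s})
      \<partial>count_space ((\<lambda>\<omega>. \<lambda>s\<in>I. source_val S s \<omega>) ` E))"
    unfolding W_def[abs_def, symmetric] using XP by (simp cong: nn_integral_cong_simp)
  have "emeasure M {\<omega> \<in> E. Q \<omega>} = (\<integral>\<^sup>+w. emeasure M (X w \<inter> {\<omega>. Q \<omega>}) \<partial>count_space (W ` E))"
    unfolding EQ using cnt XQ(1) dis by (intro emeasure_UN_countable)
  also have "\<dots> = (\<integral>\<^sup>+w. emeasure M (X w) * \<kappa> \<partial>count_space (W ` E))"
    using XQ(2) by (intro nn_integral_cong) auto
  finally show "emeasure M {\<omega> \<in> E. Q \<omega>} = emeasure M E * \<kappa>"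
    unfolding E_sum by (simp add: nn_integral_multc)
qed

text \<open>The right-hand side mentions neither \<open>M\<close> nor \<nu>, which is why events of
  these sources are equally likely under all laws. The \<open>case\<close> lists the only
  constructors in \<open>base_sources\<close>.\<close>

lemma emeasure_source_val_base:
  assumes "s \<in> base_sources m"
  shows "emeasure M {\<omega> \<in> space M. source_val S s \<omega> = v} =
    (case s of Init \<Rightarrow> emeasure (measure_pmf \<pi>) {q. Inl q = v}
     | Sampled k l \<Rightarrow> emeasure (measure_pmf (bernoulli_pmf r)) {b. Inr (Inl b) = v}
     | Pick k N \<Rightarrow> emeasure (measure_pmf (pmf_of_set N)) {l. Inr (Inr l) = v})"
proof -
  have *: "emeasure M {\<omega> \<in> space M. f \<omega> \<in> A} = emeasure (measure_pmf p) A"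
    if "f \<in> M \<rightarrow>\<^sub>M count_space UNIV" "distr M (count_space UNIV) f = measure_pmf p"
    for f :: "'w \<Rightarrow> 'a" and p A
  proof -
    have "emeasure (distr M (count_space UNIV) f) A = emeasure M (f -` A \<inter> space M)"
      using that by (intro emeasure_distr) auto
    also have "f -` A \<inter> space M = {\<omega> \<in> space M. f \<omega> \<in> A}"
      by auto
    finally show ?thesis
      using that by simp
  qed
  consider "s = Init" | k l where "s = Sampled k l" "1 \<le> k" | k N where "s = Pick k N" "1 \<le> k" "N \<noteq> {}"
    using assms unfolding base_sources_def by fastforce
  then show ?thesis
    using *[OF init_measurable init_law, of "{q. Inl q = v}"]
      *[OF sampled_measurable sampled_law, of _ _ "{b. Inr (Inl b) = v}"]
      *[OF pick_measurable pick_law, of _ _ "{l. Inr (Inr l) = v}"]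
    by cases auto
qed

lemma emeasure_channel:
  assumes "1 \<le> k"
  shows "emeasure M {\<omega> \<in> space M. channel S k \<omega> = b} =
    ennreal (pmf (bernoulli_pmf (if enat k \<le> \<nu> then p\<^sub>0 else p\<^sub>1)) b)"
proof -
  have "emeasure (distr M (count_space UNIV) (channel S k)) {b} = emeasure M (channel S k -` {b} \<inter> space M)"
    using channel_measurable[OF assms] by (intro emeasure_distr) auto
  also have "channel S k -` {b} \<inter> space M = {\<omega> \<in> space M. channel S k \<omega> = b}"
    by auto
  finally show ?thesis
    unfolding channel_law[OF assms] by (simp add: emeasure_pmf_single)
qed

lemma channel_event: "{\<omega> \<in> space M. channel S k \<omega> = b} \<in> source_events M \<mu> S (Channel k)"
  using source_val_event[of "Channel k" "Inr (Inl b)"] by simp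

lemma emeasure_reading:
  assumes "1 \<le> k" "A \<in> sets \<mu>"
  shows "emeasure M {\<omega> \<in> space M. reading S k l \<omega> \<in> A} =
    (\<integral>\<^sup>+x. (if enat k \<le> \<nu> then f\<^sub>0 else f\<^sub>1) x * indicator A x \<partial>\<mu>)"
  using distributed_emeasure[OF reading_law[OF assms(1)] assms(2)]
  by (simp add: vimage_def Int_def conj_commute)

lemma emeasure_init_reading:
  assumes "1 \<le> j" "A \<in> sets \<mu>"
  shows "emeasure M {\<omega> \<in> space M. init_reading S j l \<omega> \<in> A} = (\<integral>\<^sup>+x. f\<^sub>0 x * indicator A x \<partial>\<mu>)"
  using distributed_emeasure[OF init_reading_law[OF assms(1)] assms(2)]
  by (simp add: vimage_def Int_def conj_commute)

end

text \<open>Both probabilities are the same sum over atoms, by the last part of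
  \<open>emeasure_saturated\<close> with a trivial extra event; its summands are products of
  marginals that do not depend on the law.\<close>

lemma emeasure_base_invariant:
  fixes S :: "('w, 'l::finite, 'x) sensor_system"
  assumes "sensor_law M \<nu> \<mu> f\<^sub>0 f\<^sub>1 \<pi> r p\<^sub>0 p\<^sub>1 S" "sensor_law M' \<nu>' \<mu> f\<^sub>0 f\<^sub>1 \<pi> r p\<^sub>0 p\<^sub>1 S"
    and "space M' = space M" and E: "E \<subseteq> space M"
    and sat: "\<And>\<omega> \<omega>'. \<omega> \<in> E \<Longrightarrow> \<omega>' \<in> space M \<Longrightarrow> agree_upto m S \<omega> S \<omega>' \<Longrightarrow> \<omega>' \<in> E"
  shows "emeasure M E = emeasure M' E"
proof -
  interpret M: sensor_law M \<nu> \<mu> f\<^sub>0 f\<^sub>1 \<pi> r p\<^sub>0 p\<^sub>1 S by fact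
  interpret M': sensor_law M' \<nu>' \<mu> f\<^sub>0 f\<^sub>1 \<pi> r p\<^sub>0 p\<^sub>1 S by fact
  let ?I = "base_sources m :: 'l source set"
  have I: "finite ?I" "?I \<subseteq> sources" "\<And>s. s \<in> ?I \<Longrightarrow> \<not> is_reading s"
    using finite_base_sources base_sources_subset[of m] by auto
  have "emeasure M E = (\<integral>\<^sup>+w. (\<Prod>s\<in>?I. emeasure M {\<omega> \<in> space M. source_val S s \<omega> = w s})
      \<partial>count_space ((\<lambda>\<omega>. \<lambda>s\<in>?I. source_val S s \<omega>) ` E))"
    by (rule M.emeasure_saturated(4)[OF I E, where Q = "\<lambda>_. True" and \<kappa> = 1])
      (use sat in \<open>auto simp: agree_upto_iff_source_val intro!: exI[of _ "{}"]\<close>)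
  moreover have "emeasure M' E = (\<integral>\<^sup>+w. (\<Prod>s\<in>?I. emeasure M' {\<omega> \<in> space M'. source_val S s \<omega> = w s})
      \<partial>count_space ((\<lambda>\<omega>. \<lambda>s\<in>?I. source_val S s \<omega>) ` E))"
    by (rule M'.emeasure_saturated(4)[OF I, where Q = "\<lambda>_. True" and \<kappa> = 1])
      (use sat E assms(3) in \<open>auto simp: agree_upto_iff_source_val intro!: exI[of _ "{}"]\<close>)
  ultimately show ?thesis
    by (simp add: M.emeasure_source_val_base M'.emeasure_source_val_base cong: prod.cong)
qed

section \<open>The law of the observations\<close>

definition start_event ::
    "'w measure \<Rightarrow> ('w, 'l, 'x) sensor_system \<Rightarrow> nat \<Rightarrow> ('l \<Rightarrow> nat) \<Rightarrow> ('l \<Rightarrow> nat) \<Rightarrow> 'w set" where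
  "start_event M S c q a = {\<omega> \<in> space M. init_queue S \<omega> = q \<and> arrivals S c \<omega> = a}"

text \<open>The part of the event of seeing a given delivery record that does not involve the
  channel, obtained by prescribing the channel outcomes of the record.\<close>

definition path_event ::
    "'w measure \<Rightarrow> ('w, 'l, 'x) sensor_system \<Rightarrow> nat \<Rightarrow> ('l \<Rightarrow> nat) \<Rightarrow> ('l \<Rightarrow> nat) \<Rightarrow> nat \<Rightarrow>
      (nat \<Rightarrow> 'l option) \<Rightarrow> (nat \<Rightarrow> bool option) \<Rightarrow> (nat \<Rightarrow> nat option) \<Rightarrow> 'w set" where
  "path_event M S c q a n u y j =
     {\<omega> \<in> start_event M S c q a. \<forall>k\<in>{1..n}. obs_U (forced S y) k \<omega> = u k \<and>
        obs_Y (forced S y) k \<omega> = y k \<and> obs_J (forced S y) k \<omega> = j k}"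

lemma path_event_subset: "path_event M S c q a n u y j \<subseteq> space M"
  by (auto simp: path_event_def start_event_def)

text \<open>Carries facts on path events, such as invariance under the law, over to the conditioning
  event.\<close>

lemma path_event_0: "path_event M S c q a 0 u y j = start_event M S c q a"
  by (simp add: path_event_def)

text \<open>Slots up to \<open>n\<close> determine the forced record and slots up to
  \<open>c\<close> the arrivals, hence \<open>max n c\<close>. The forced channel is the same for
  both outcomes.\<close>

lemma path_event_saturated:
  fixes S :: "('w, 'l::finite, 'x) sensor_system"
  assumes "\<omega> \<in> path_event M S c q a n u y j" "\<omega>' \<in> space M" "agree_upto (max n c) S \<omega> S \<omega>'"
  shows "\<omega>' \<in> path_event M S c q a n u y j"
proof -
  have "agree_upto (max n c) (forced S y) \<omega> (forced S y) \<omega>'"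
    using assms(3) by (simp add: agree_upto_forced)
  from obs_cong[OF this]
  have "obs_U (forced S y) k \<omega>' = obs_U (forced S y) k \<omega> \<and> obs_Y (forced S y) k \<omega>' = obs_Y (forced S y) k \<omega> \<and>
      obs_J (forced S y) k \<omega>' = obs_J (forced S y) k \<omega>" if "k \<in> {1..n}" for k
    using that by (simp add: le_max_iff_disj)
  moreover have "init_queue S \<omega> = init_queue S \<omega>'" "arrivals S c \<omega> = arrivals S c \<omega>'"
    using assms(3) arrivals_cong[OF assms(3), of c] by (auto simp: agree_upto_def)
  ultimately show ?thesis
    using assms(1,2) by (simp add: path_event_def start_event_def)
qed

text \<open>An idle slot has the certain outcome \<open>None\<close>, hence the factor 1.\<close>

definition channel_density :: "enat \<Rightarrow> real \<Rightarrow> real \<Rightarrow> nat \<Rightarrow> bool option \<Rightarrow> ennreal" where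
  "channel_density \<nu> p\<^sub>0 p\<^sub>1 k y =
     (case y of None \<Rightarrow> 1 | Some b \<Rightarrow> ennreal (pmf (bernoulli_pmf (if enat k \<le> \<nu> then p\<^sub>0 else p\<^sub>1)) b))"

definition packet_density ::
    "enat \<Rightarrow> ('x \<Rightarrow> ennreal) \<Rightarrow> ('x \<Rightarrow> ennreal) \<Rightarrow> ('l \<Rightarrow> nat) \<Rightarrow> ('l \<Rightarrow> nat) \<Rightarrow> 'l \<Rightarrow> nat \<Rightarrow> 'x \<Rightarrow> ennreal" where
  "packet_density \<nu> f\<^sub>0 f\<^sub>1 q a l j = (if \<nu> = \<infinity> \<or> j \<le> q l + a l then f\<^sub>0 else f\<^sub>1)"

text \<open>A density for \<open>option_measure\<close>: without a delivery the value is
  \<open>None\<close>, an atom of mass 1; with a delivery \<open>None\<close> gets density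
  0.\<close>

definition reading_density ::
    "enat \<Rightarrow> ('x \<Rightarrow> ennreal) \<Rightarrow> ('x \<Rightarrow> ennreal) \<Rightarrow> ('l \<Rightarrow> nat) \<Rightarrow> ('l \<Rightarrow> nat) \<Rightarrow>
      'l option \<Rightarrow> nat option \<Rightarrow> 'x option \<Rightarrow> ennreal" where
  "reading_density \<nu> f\<^sub>0 f\<^sub>1 q a u j z =
     (case u of None \<Rightarrow> indicator {None} z
      | Some l \<Rightarrow> (case z of None \<Rightarrow> 0 | Some x \<Rightarrow> packet_density \<nu> f\<^sub>0 f\<^sub>1 q a l (the j) x))"

lemma arrivals_forced [simp]: "arrivals (forced S y) = arrivals S"
  by (simp add: fun_eq_iff arrivals_def)

context sensor_law
begin

text \<open>By \<open>sampling_slot\<close>, whether the reading precedes slot \<open>Suc c\<close>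
  is a matter of its index. The sampling slot disappears from the result, which depends on \<omega>
  only through the initial queues and the arrivals up to \<open>c\<close>.\<close>

lemma packet_source_law:
  assumes i: "1 \<le> i" "i \<le> init_queue S \<omega> l + arrivals S m \<omega> l" and \<nu>: "\<nu> \<in> {enat c, \<infinity>}"
  shows "packet_source S i l \<omega> \<in> sources" "is_reading (packet_source S i l \<omega>)"
    "A \<in> sets \<mu> \<Longrightarrow> emeasure M {\<omega>' \<in> space M. source_reading S (packet_source S i l \<omega>) \<omega>' \<in> A} =
      (\<integral>\<^sup>+x. packet_density \<nu> f\<^sub>0 f\<^sub>1 (init_queue S \<omega>) (arrivals S c \<omega>) l i x * indicator A x \<partial>\<mu>)"
proof -
  let ?t = "LEAST k. i \<le> init_queue S \<omega> l + arrivals S k \<omega> l"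
  have late: "1 \<le> ?t" "?t \<le> c \<longleftrightarrow> i \<le> init_queue S \<omega> l + arrivals S c \<omega> l" if "\<not> i \<le> init_queue S \<omega> l"
    using sampling_slot[where S = S and \<omega> = \<omega> and l = l and j = i and m = m] that i by auto
  show "packet_source S i l \<omega> \<in> sources" "is_reading (packet_source S i l \<omega>)"
    using late(1) i by (auto simp: packet_source_def sources_def)
  show "emeasure M {\<omega>' \<in> space M. source_reading S (packet_source S i l \<omega>) \<omega>' \<in> A} =
      (\<integral>\<^sup>+x. packet_density \<nu> f\<^sub>0 f\<^sub>1 (init_queue S \<omega>) (arrivals S c \<omega>) l i x * indicator A x \<partial>\<mu>)"
    if A: "A \<in> sets \<mu>"
  proof (cases "i \<le> init_queue S \<omega> l")
    case True
    then show ?thesis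
      using emeasure_init_reading[OF i(1) A] by (simp add: packet_source_def packet_density_def)
  next
    case False
    have "(if enat ?t \<le> \<nu> then f\<^sub>0 else f\<^sub>1) = packet_density \<nu> f\<^sub>0 f\<^sub>1 (init_queue S \<omega>) (arrivals S c \<omega>) l i"
      using \<nu> late(2)[OF False] by (auto simp: packet_density_def)
    then show ?thesis
      using emeasure_reading[OF late(1)[OF False] A] False by (simp add: packet_source_def)
  qed
qed

text \<open>\<open>emeasure_saturated\<close> applies to the path event: on each atom of the base
  sources the remaining conditions concern channels and readings outside them, with the same joint
  probability on all atoms. An inconsistent record is covered as well, its path event being
  empty.\<close>

lemma emeasure_record:
  fixes u :: "nat \<Rightarrow> 'l option" and y :: "nat \<Rightarrow> bool option" and j :: "nat \<Rightarrow> nat option"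
    and q a :: "'l \<Rightarrow> nat" and A :: "nat \<Rightarrow> 'x option set"
  assumes \<nu>: "\<nu> \<in> {enat c, \<infinity>}"
    and A: "\<And>k. k \<in> {1..n} \<Longrightarrow> A k \<in> sets (option_measure \<mu>)"
  defines "X \<equiv> {\<omega> \<in> start_event M S c q a. \<forall>k\<in>{1..n}.
      obs_U S k \<omega> = u k \<and> obs_Y S k \<omega> = y k \<and> obs_J S k \<omega> = j k \<and> obs_Z S k \<omega> \<in> A k}"
    and "\<zeta> \<equiv> \<lambda>k. case u k of None \<Rightarrow> indicator (A k) None
      | Some l \<Rightarrow> (\<integral>\<^sup>+x. packet_density \<nu> f\<^sub>0 f\<^sub>1 q a l (the (j k)) x * indicator (Some -` A k) x \<partial>\<mu>)"
  shows "X \<in> events"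
    "emeasure M X = emeasure M (path_event M S c q a n u y j) *
      (\<Prod>k\<in>{1..n}. channel_density \<nu> p\<^sub>0 p\<^sub>1 k (y k) * \<zeta> k)"
proof -
  define m where "m = max n c"
  define K where "K = {1..n}"
  define E where "E = path_event M S c q a n u y j"
  let ?T = "forced S y"
  have pick: "pick S k N \<omega> \<in> N" if "\<omega> \<in> space M" "1 \<le> k" "N \<noteq> {}" for \<omega> k N
    using pick_nonempty that by auto
  define C where "C \<omega> \<longleftrightarrow> (\<forall>k\<in>K. y k \<noteq> None \<longrightarrow> channel S k \<omega> = (y k = Some True))" for \<omega>
  have obs: "(\<forall>k\<in>K. obs_U S k \<omega> = u k \<and> obs_Y S k \<omega> = y k \<and> obs_J S k \<omega> = j k)
    \<longleftrightarrow> \<omega> \<in> E \<and> C \<omega>" if "\<omega> \<in> start_event M S c q a" for \<omega>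
    using observed_iff_forced[of n S \<omega> u y j] that by (simp add: E_def path_event_def K_def C_def)
  have E_start: "E \<subseteq> start_event M S c q a"
    by (auto simp: E_def path_event_def)
  have X: "X = {\<omega> \<in> E. C \<omega> \<and> (\<forall>k\<in>K. obs_Z S k \<omega> \<in> A k)}"
    using obs E_start unfolding X_def K_def[symmetric] by (auto; blast)
  have "X \<in> events \<and> emeasure M X = emeasure M E * (\<Prod>k\<in>K. channel_density \<nu> p\<^sub>0 p\<^sub>1 k (y k) * \<zeta> k)"
  \<comment> \<open>A slot without delivery yields \<open>None\<close>, so excluding
    \<open>None\<close> there makes both sides 0. Otherwise such slots satisfy their condition
    automatically and contribute the factor 1.\<close>
  proof (cases "\<exists>k\<in>K. u k = None \<and> None \<notin> A k")
    case True
    then obtain k where k: "k \<in> K" "u k = None" "None \<notin> A k"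
      by auto
    then have "X = {}"
      unfolding X_def K_def[symmetric] by (fastforce simp: obs_Z_def)
    moreover have "\<zeta> k = 0"
      using k by (simp add: \<zeta>_def)
    then have "(\<Prod>k\<in>K. channel_density \<nu> p\<^sub>0 p\<^sub>1 k (y k) * \<zeta> k) = 0"
      using k(1) by (intro prod_zero) (auto simp: K_def)
    ultimately show ?thesis
      by simp
  next
    case False
    let ?I = "base_sources m :: 'l source set"
    have I: "finite ?I" "?I \<subseteq> sources" "\<And>s. s \<in> ?I \<Longrightarrow> \<not> is_reading s"
      using finite_base_sources base_sources_subset[of m] by auto
    have sat: "\<omega>' \<in> E" if "\<omega> \<in> E" "\<omega>' \<in> space M" "\<forall>s\<in>?I. source_val S s \<omega> = source_val S s \<omega>'" for \<omega> \<omega>'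
      using path_event_saturated[of \<omega> M S c q a n u y j \<omega>'] that
      by (simp add: E_def m_def agree_upto_iff_source_val)
    \<comment> \<open>Within the path event, slots with a transmission constrain the channel and
      slots with a delivery also constrain a reading.\<close>
    define KY where "KY = {k \<in> K. y k \<noteq> None}"
    define KU where "KU = {k \<in> K. u k \<noteq> None}"
    have fin: "finite KY" "finite KU" "finite K"
      by (simp_all add: KY_def KU_def K_def)
    have indep: "\<exists>J P. finite J \<and> J \<subseteq> sources - ?I \<and>
        (\<forall>s\<in>J. {\<omega> \<in> space M. P s \<omega>} \<in> source_events M \<mu> S s) \<and>
        (\<forall>\<omega>\<in>space M. (\<forall>s\<in>?I. source_val S s \<omega>0 = source_val S s \<omega>) \<longrightarrow>
          ((C \<omega> \<and> (\<forall>k\<in>K. obs_Z S k \<omega> \<in> A k)) \<longleftrightarrow> (\<forall>s\<in>J. P s \<omega>))) \<and>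
        (\<Prod>s\<in>J. emeasure M {\<omega> \<in> space M. P s \<omega>}) = (\<Prod>k\<in>K. channel_density \<nu> p\<^sub>0 p\<^sub>1 k (y k) * \<zeta> k)"
      if \<omega>0: "\<omega>0 \<in> E" for \<omega>0
    proof -
      \<comment> \<open>The record fixes sensor and index of each delivered packet, so
        \<open>the\<close> matters only on \<open>KU\<close>. The source depends on the atom of
        \<open>\<omega>0\<close> as well.\<close>
      have sp: "\<omega>0 \<in> space M" "init_queue S \<omega>0 = q" "arrivals S c \<omega>0 = a"
        using \<omega>0 by (auto simp: E_def path_event_def start_event_def)
      define i where "i k = the (j k)" for k
      define l where "l k = the (u k)" for k
      define src where "src k = packet_source S (i k) (l k) \<omega>0" for k
      have U: "obs_U ?T k \<omega>0 = Some (l k)" "i k = delivered ?T k \<omega>0 (l k)" if "k \<in> KU" for k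
      proof -
        have "u k = obs_U ?T k \<omega>0" "j k = obs_J ?T k \<omega>0" "u k \<noteq> None"
          using that \<omega>0 by (auto simp: KU_def K_def E_def path_event_def)
        then show "obs_U ?T k \<omega>0 = Some (l k)" "i k = delivered ?T k \<omega>0 (l k)"
          by (auto simp: i_def l_def obs_J_eq)
      qed
      have i: "1 \<le> i k" "i k \<le> init_queue S \<omega>0 (l k) + arrivals S m \<omega>0 (l k)" if k: "k \<in> KU" for k
      proof -
        have k1: "1 \<le> k" "k - 1 \<le> m"
          using k by (auto simp: KU_def K_def m_def)
        have pT: "\<And>k N. 1 \<le> k \<Longrightarrow> N \<noteq> {} \<Longrightarrow> pick ?T k N \<omega>0 \<in> N"
          using pick[OF sp(1)] by simp
        show "1 \<le> i k" "i k \<le> init_queue S \<omega>0 (l k) + arrivals S m \<omega>0 (l k)"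
          using delivered_bounds[OF pT k1(1) U(1)[OF k]] arrivals_mono[OF k1(2), of S \<omega>0 "l k"]
          by (auto simp: U(2)[OF k])
      qed
      \<comment> \<open>Distinct deliveries use distinct sources, so each source carries one
        condition and the probabilities multiply.\<close>
      have inj: "inj_on src KU"
      proof (rule inj_onI)
        fix k k' assume k: "k \<in> KU" "k' \<in> KU" "src k = src k'"
        then have "i k = i k' \<and> l k = l k'"
          using i unfolding src_def by (intro packet_source_inj[where m = m and S = S and \<omega> = \<omega>0]) auto
        then show "k = k'"
          using k U[OF k(1)] U[OF k(2)] by (intro delivered_inj[of ?T k \<omega>0 "l k"]) (auto simp: KU_def K_def)
      qed
      have src: "src k \<in> sources" "is_reading (src k)" if "k \<in> KU" for k
        using packet_source_law[OF i[OF that] \<nu>] by (simp_all add: src_def)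
      have Channel_src: "Channel k \<noteq> src k'" if "k' \<in> KU" for k k'
        using src(2)[OF that] by (cases "src k'") auto
      define J where "J = Channel ` KY \<union> src ` KU"
      \<comment> \<open>By injectivity the quantifier meets only one slot; this expresses the
        condition without inverting \<open>src\<close>.\<close>
      define P where "P s \<omega> = (case s of Channel k \<Rightarrow> channel S k \<omega> = (y k = Some True)
        | _ \<Rightarrow> \<forall>k\<in>KU. src k = s \<longrightarrow> source_reading S s \<omega> \<in> Some -` A k)" for s \<omega>
      have P_src: "P (src k) \<omega> \<longleftrightarrow> source_reading S (src k) \<omega> \<in> Some -` A k" if k: "k \<in> KU" for k \<omega>
      proof -
        have "P (src k) \<omega> \<longleftrightarrow> (\<forall>k'\<in>KU. src k' = src k \<longrightarrow> source_reading S (src k) \<omega> \<in> Some -` A k')"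
          using src(2)[OF k] by (cases "src k") (simp_all add: P_def)
        also have "\<dots> \<longleftrightarrow> source_reading S (src k) \<omega> \<in> Some -` A k"
          using inj_onD[OF inj _ _ k] k by blast
        finally show ?thesis .
      qed
      have A': "Some -` A k \<in> sets \<mu>" if "k \<in> KU" for k
        using A[of k] that by (auto simp: KU_def K_def sets_option_measure)
      have J_sub: "J \<subseteq> sources - ?I"
      proof -
        have "Channel k \<in> sources" if "k \<in> KY" for k :: nat
          using that by (auto simp: KY_def K_def sources_def)
        then show ?thesis
          using src base_sources_subset[of m] unfolding J_def by blast
      qed
      have ev: "{\<omega> \<in> space M. P s \<omega>} \<in> source_events M \<mu> S s" if "s \<in> J" for s
        using that sets_source_events_reading[OF src A'] channel_event
        by (auto simp: J_def P_src P_def[of "Channel _"])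
      have PQ: "(C \<omega> \<and> (\<forall>k\<in>K. obs_Z S k \<omega> \<in> A k)) \<longleftrightarrow> (\<forall>s\<in>J. P s \<omega>)"
        if \<omega>: "\<omega> \<in> space M" "\<forall>s\<in>?I. source_val S s \<omega>0 = source_val S s \<omega>" for \<omega>
      proof -
        have ag: "agree_upto m S \<omega>0 S \<omega>"
          using \<omega>(2) by (simp add: agree_upto_iff_source_val)
        have E: "\<omega> \<in> E"
          using sat[OF \<omega>0 \<omega>] .
        have CJ: "C \<omega> \<longleftrightarrow> (\<forall>s\<in>Channel ` KY. P s \<omega>)"
          by (auto simp: C_def P_def KY_def)
        have "(\<forall>k\<in>K. obs_Z S k \<omega> \<in> A k) \<longleftrightarrow> (\<forall>k\<in>KU. P (src k) \<omega>)" if "C \<omega>"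
        proof -
          have o: "obs_U S k \<omega> = u k" "obs_J S k \<omega> = j k" if "k \<in> K" for k
            using obs[of \<omega>] E E_start \<open>C \<omega>\<close> that by auto
          have Z0: "obs_Z S k \<omega> \<in> A k" if "k \<in> K" "k \<notin> KU" for k
            using o[of k] that False by (auto simp: obs_Z_def KU_def)
          have Z1: "obs_Z S k \<omega> \<in> A k \<longleftrightarrow> P (src k) \<omega>" if "k \<in> KU" for k
          proof -
            have "k \<in> K" "u k = Some (l k)"
              using that by (auto simp: KU_def l_def)
            then have "obs_Z S k \<omega> = Some (packet S (i k) (l k) \<omega>)"
              using o[of k] by (simp add: obs_Z_def i_def)
            also have "\<dots> = Some (source_reading S (src k) \<omega>)"
              unfolding packet_eq_source_reading src_def using packet_source_cong[OF ag i(2)[OF that]] by simp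
            finally show ?thesis
              using P_src[OF that] by simp
          qed
          show ?thesis
            using Z0 Z1 by (auto simp: KU_def)
        qed
        with CJ show ?thesis
          by (auto simp: J_def)
      qed
      have "(\<Prod>s\<in>J. emeasure M {\<omega> \<in> space M. P s \<omega>}) =
          (\<Prod>s\<in>Channel ` KY. emeasure M {\<omega> \<in> space M. P s \<omega>}) * (\<Prod>s\<in>src ` KU. emeasure M {\<omega> \<in> space M. P s \<omega>})"
        unfolding J_def using fin Channel_src by (intro prod.union_disjoint) auto
      also have "(\<Prod>s\<in>Channel ` KY. emeasure M {\<omega> \<in> space M. P s \<omega>}) =
          (\<Prod>k\<in>KY. emeasure M {\<omega> \<in> space M. channel S k \<omega> = (y k = Some True)})"
        by (subst prod.reindex) (auto simp: inj_on_def P_def)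
      also have "\<dots> = (\<Prod>k\<in>KY. channel_density \<nu> p\<^sub>0 p\<^sub>1 k (y k))"
        by (intro prod.cong) (auto simp: KY_def K_def emeasure_channel channel_density_def)
      also have "\<dots> = (\<Prod>k\<in>K. channel_density \<nu> p\<^sub>0 p\<^sub>1 k (y k))"
        by (intro prod.mono_neutral_left fin) (auto simp: KY_def channel_density_def)
      also have "(\<Prod>s\<in>src ` KU. emeasure M {\<omega> \<in> space M. P s \<omega>}) =
          (\<Prod>k\<in>KU. emeasure M {\<omega> \<in> space M. P (src k) \<omega>})"
        by (subst prod.reindex[OF inj]) simp
      \<comment> \<open>Here the dependence on \<open>\<omega>0\<close> drops out: the law of
        \<open>src k\<close> involves only \<open>q\<close>, \<open>a\<close> and the
        record.\<close>
      also have "\<dots> = (\<Prod>k\<in>KU. \<zeta> k)"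
      proof (intro prod.cong refl)
        fix k assume k: "k \<in> KU"
        then have "u k = Some (l k)"
          by (auto simp: KU_def l_def)
        then show "emeasure M {\<omega> \<in> space M. P (src k) \<omega>} = \<zeta> k"
          using packet_source_law(3)[OF i[OF k] \<nu> A'[OF k]] unfolding P_src[OF k]
          by (simp add: src_def \<zeta>_def i_def sp)
      qed
      also have "\<dots> = (\<Prod>k\<in>K. \<zeta> k)"
        by (intro prod.mono_neutral_left fin) (use False in \<open>auto simp: KU_def \<zeta>_def\<close>)
      finally have "(\<Prod>s\<in>J. emeasure M {\<omega> \<in> space M. P s \<omega>}) =
          (\<Prod>k\<in>K. channel_density \<nu> p\<^sub>0 p\<^sub>1 k (y k) * \<zeta> k)"
        by (simp add: prod.distrib)
      then show ?thesis
        using J_sub ev PQ fin by (intro exI[of _ J] exI[of _ P]) (auto simp: J_def)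
    qed
    have ES: "E \<subseteq> space M"
      unfolding E_def by (rule path_event_subset)
    show ?thesis
      unfolding X using emeasure_saturated(1,3)[OF I ES sat indep] by auto
  qed
  then show "X \<in> events"
    "emeasure M X = emeasure M (path_event M S c q a n u y j) *
      (\<Prod>k\<in>{1..n}. channel_density \<nu> p\<^sub>0 p\<^sub>1 k (y k) * \<zeta> k)"
    by (auto simp: K_def E_def)
qed

end

section \<open>Density of the observations given the initial queues and the arrivals up to the
  cut-off\<close>

definition slot_density ::
    "enat \<Rightarrow> ('x \<Rightarrow> ennreal) \<Rightarrow> ('x \<Rightarrow> ennreal) \<Rightarrow> real \<Rightarrow> real \<Rightarrow> ('l \<Rightarrow> nat) \<Rightarrow> ('l \<Rightarrow> nat) \<Rightarrow>
      nat \<Rightarrow> 'l option \<times> bool option \<times> nat option \<times> 'x option \<Rightarrow> ennreal" where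
  "slot_density \<nu> f\<^sub>0 f\<^sub>1 p\<^sub>0 p\<^sub>1 q a k = (\<lambda>(u, y, j, z).
     channel_density \<nu> p\<^sub>0 p\<^sub>1 k y * reading_density \<nu> f\<^sub>0 f\<^sub>1 q a u j z)"

text \<open>The quotient of probabilities still mentions \<open>M\<close>, but by
  \<open>emeasure_base_invariant\<close> it is the same for all laws of the family and cancels in
  the ratio.\<close>

definition obs_density ::
    "enat \<Rightarrow> ('x \<Rightarrow> ennreal) \<Rightarrow> ('x \<Rightarrow> ennreal) \<Rightarrow> real \<Rightarrow> real \<Rightarrow> 'w measure \<Rightarrow>
      ('w, 'l, 'x) sensor_system \<Rightarrow> nat \<Rightarrow> ('l \<Rightarrow> nat) \<Rightarrow> ('l \<Rightarrow> nat) \<Rightarrow> nat \<Rightarrow>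
      (nat \<Rightarrow> 'l option \<times> bool option \<times> nat option \<times> 'x option) \<Rightarrow> ennreal" where
  "obs_density \<nu> f\<^sub>0 f\<^sub>1 p\<^sub>0 p\<^sub>1 M S c q a n v =
     emeasure M (path_event M S c q a n (\<lambda>k\<in>{1..n}. fst (v k)) (\<lambda>k\<in>{1..n}. fst (snd (v k)))
       (\<lambda>k\<in>{1..n}. fst (snd (snd (v k))))) / emeasure M (start_event M S c q a) *
     (\<Prod>k\<in>{1..n}. slot_density \<nu> f\<^sub>0 f\<^sub>1 p\<^sub>0 p\<^sub>1 q a k (v k))"

lemma restrict_record_box:
  assumes "v \<in> record_box n u y j A" "u \<in> extensional {1..n}" "y \<in> extensional {1..n}" "j \<in> extensional {1..n}"
  shows "(\<lambda>k\<in>{1..n}. fst (v k)) = u" "(\<lambda>k\<in>{1..n}. fst (snd (v k))) = y"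
    "(\<lambda>k\<in>{1..n}. fst (snd (snd (v k)))) = j"
proof -
  have v: "\<exists>z. v k = (u k, y k, j k, z)" if "k \<in> {1..n}" for k
    using assms(1) that unfolding mem_record_box by blast
  then have "fst (v k) = u k" "fst (snd (v k)) = y k" "fst (snd (snd (v k))) = j k" if "k \<in> {1..n}" for k
    using v[OF that] by auto
  with assms(2-) show "(\<lambda>k\<in>{1..n}. fst (v k)) = u" "(\<lambda>k\<in>{1..n}. fst (snd (v k))) = y"
    "(\<lambda>k\<in>{1..n}. fst (snd (snd (v k)))) = j"
    by (intro extensionalityI[where A = "{1..n}"]; auto)+
qed

context sensor_law
begin

lemma f0_measurable: "f\<^sub>0 \<in> borel_measurable \<mu>"
  using distributed_borel_measurable[OF init_reading_law[of 1]] by simp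

text \<open>Measurability of \<open>f\<^sub>1\<close> comes from a reading after the change, in slot
  \<open>Suc c\<close>; for \<nu> infinite the density is \<open>f\<^sub>0\<close>
  throughout.\<close>

lemma packet_density_measurable:
  assumes "\<nu> \<in> {enat c, \<infinity>}"
  shows "packet_density \<nu> f\<^sub>0 f\<^sub>1 q a l i \<in> borel_measurable \<mu>"
proof -
  have "f\<^sub>1 \<in> borel_measurable \<mu>" if "\<nu> = enat c"
    using distributed_borel_measurable[OF reading_law[of "Suc c"]] that by simp
  then show ?thesis
    using assms f0_measurable by (auto simp: packet_density_def)
qed

lemma reading_density_measurable:
  assumes "\<nu> \<in> {enat c, \<infinity>}"
  shows "reading_density \<nu> f\<^sub>0 f\<^sub>1 q a u j \<in> borel_measurable (option_measure \<mu>)"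
  using packet_density_measurable[OF assms]
  by (intro measurable_option_measure; cases u) (auto simp: reading_density_def)

lemma slot_density_measurable:
  fixes q a :: "'l \<Rightarrow> nat"
  assumes "\<nu> \<in> {enat c, \<infinity>}"
  shows "slot_density \<nu> f\<^sub>0 f\<^sub>1 p\<^sub>0 p\<^sub>1 q a k \<in> borel_measurable (slot_measure \<mu>)"
proof -
  have [measurable]: "(\<lambda>z. slot_density \<nu> f\<^sub>0 f\<^sub>1 p\<^sub>0 p\<^sub>1 q a k (u, y, j, z)) \<in> borel_measurable (option_measure \<mu>)"
    for u y j
    unfolding slot_density_def prod.case
    by (intro borel_measurable_times_ennreal borel_measurable_const reading_density_measurable[OF assms])
  show ?thesis
    by (rule measurable_pair_measure_countable1, simp, rule measurable_pair_measure_countable1, simp,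
        rule measurable_pair_measure_countable1, simp, measurable)
qed

text \<open>The result has exactly the form of the slot factors in \<open>emeasure_record\<close>,
  which matches the density with the law.\<close>

lemma nn_integral_slot_density:
  fixes q a :: "'l \<Rightarrow> nat"
  assumes "\<nu> \<in> {enat c, \<infinity>}" "sigma_finite_measure \<mu>" "A \<in> sets (option_measure \<mu>)"
  shows "(\<integral>\<^sup>+w. slot_density \<nu> f\<^sub>0 f\<^sub>1 p\<^sub>0 p\<^sub>1 q a k w * indicator ({u} \<times> {y} \<times> {j} \<times> A) w \<partial>slot_measure \<mu>) =
    channel_density \<nu> p\<^sub>0 p\<^sub>1 k y * (case u of None \<Rightarrow> indicator A None
      | Some l \<Rightarrow> (\<integral>\<^sup>+x. packet_density \<nu> f\<^sub>0 f\<^sub>1 q a l (the j) x * indicator (Some -` A) x \<partial>\<mu>))"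
proof -
  let ?g = "reading_density \<nu> f\<^sub>0 f\<^sub>1 q a u j"
  note [measurable] = assms(3) reading_density_measurable[OF assms(1)]
  have "(\<integral>\<^sup>+w. slot_density \<nu> f\<^sub>0 f\<^sub>1 p\<^sub>0 p\<^sub>1 q a k w * indicator ({u} \<times> {y} \<times> {j} \<times> A) w \<partial>slot_measure \<mu>) =
    (\<integral>\<^sup>+z. channel_density \<nu> p\<^sub>0 p\<^sub>1 k y * (?g z * indicator A z) \<partial>option_measure \<mu>)"
    unfolding nn_integral_slot_measure[OF assms(2) slot_density_measurable[OF assms(1)] assms(3)]
    by (simp add: slot_density_def ac_simps)
  also have "\<dots> = channel_density \<nu> p\<^sub>0 p\<^sub>1 k y * (\<integral>\<^sup>+z. ?g z * indicator A z \<partial>option_measure \<mu>)"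
    by (intro nn_integral_cmult) measurable
  also have "(\<integral>\<^sup>+z. ?g z * indicator A z \<partial>option_measure \<mu>) =
      (\<integral>\<^sup>+x. ?g (Some x) * indicator A (Some x) \<partial>\<mu>) + ?g None * indicator A None"
    by (intro nn_integral_option_measure) measurable
  also have "\<dots> = (case u of None \<Rightarrow> indicator A None
      | Some l \<Rightarrow> (\<integral>\<^sup>+x. packet_density \<nu> f\<^sub>0 f\<^sub>1 q a l (the j) x * indicator (Some -` A) x \<partial>\<mu>))"
    by (cases u) (simp_all add: reading_density_def indicator_def)
  finally show ?thesis .
qed

lemma start_event_events: "start_event M S c q a \<in> events"
proof -
  have "(\<lambda>\<omega>. init_queue S \<omega>) -` {q} \<inter> space M \<in> events"
    by (intro measurable_sets[OF init_measurable]) auto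
  moreover have "{\<omega> \<in> space M. arrivals S c \<omega> = a} \<in> events"
  proof -
    have [measurable]: "Measurable.pred M (sampled S k l)" if "k \<in> {1..c}" for k l
      using sampled_measurable that by simp
    \<comment> \<open>As a finite sum the count is measurable; with finitely many sensors, equality
      of functions is then a finite conjunction.\<close>
    have "(\<lambda>\<omega>. \<Sum>k\<in>{1..c}. of_bool (sampled S k l \<omega>)) \<in> M \<rightarrow>\<^sub>M count_space (UNIV :: nat set)" for l
      by measurable
    moreover have "arrivals S c \<omega> l = (\<Sum>k\<in>{1..c}. of_bool (sampled S k l \<omega>))" for l \<omega>
      by (simp add: arrivals_def of_bool_def sum.If_cases Int_def)
    ultimately have [measurable]: "(\<lambda>\<omega>. arrivals S c \<omega> l) \<in> M \<rightarrow>\<^sub>M count_space UNIV" for l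
      by simp
    have "{\<omega> \<in> space M. \<forall>l. arrivals S c \<omega> l = a l} \<in> events"
      by measurable
    then show ?thesis
      by (simp add: fun_eq_iff)
  qed
  moreover have "start_event M S c q a =
      ((\<lambda>\<omega>. init_queue S \<omega>) -` {q} \<inter> space M) \<inter> {\<omega> \<in> space M. arrivals S c \<omega> = a}"
    by (auto simp: start_event_def)
  ultimately show ?thesis
    by auto
qed

text \<open>A delivered packet was queued initially or sampled in a slot from 1 on, so the locale
  specifies the law of its source.\<close>

lemma delivered_packet_source:
  assumes "\<omega> \<in> space M" "1 \<le> k" "obs_U S k \<omega> = Some l"
  shows "packet_source S (delivered S k \<omega> l) l \<omega> \<in> sources"
    "is_reading (packet_source S (delivered S k \<omega> l) l \<omega>)"
proof -
  let ?i = "delivered S k \<omega> l"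
  let ?s = "packet_source S ?i l \<omega>"
  have pk: "\<And>k N. 1 \<le> k \<Longrightarrow> N \<noteq> {} \<Longrightarrow> pick S k N \<omega> \<in> N"
    using pick_nonempty assms(1) by auto
  note b = delivered_bounds[OF pk assms(2,3)]
  have "?i \<le> init_queue S \<omega> l \<Longrightarrow> ?s = InitReading ?i l"
    by (simp add: packet_source_def)
  moreover have "\<exists>t\<ge>1. ?s = Reading t l" if "\<not> ?i \<le> init_queue S \<omega> l"
    using sampling_slot(1)[where S = S and \<omega> = \<omega> and l = l and j = ?i and m = "k - 1"] that b
    by (auto simp: packet_source_def)
  ultimately show "?s \<in> sources" "is_reading ?s"
    using b(1) by (cases "?i \<le> init_queue S \<omega> l"; force simp: sources_def)+
qed

lemma obs_Z_space:
  assumes "\<omega> \<in> space M" "1 \<le> k"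
  shows "obs_Z S k \<omega> \<in> space (option_measure \<mu>)"
proof (cases "obs_U S k \<omega>")
  case None
  then show ?thesis
    by (simp add: obs_Z_def space_option_measure)
next
  case (Some l)
  let ?s = "packet_source S (delivered S k \<omega> l) l \<omega>"
  have "source_reading S ?s \<omega> \<in> space \<mu>"
    using reading_law init_reading_law assms(1) delivered_packet_source[OF assms Some]
    by (cases ?s) (auto simp: sources_def dest!: distributed_measurable measurable_space)
  then show ?thesis
    using Some by (simp add: obs_Z_def obs_J_eq packet_eq_source_reading space_option_measure)
qed

text \<open>Events about one slot are countable unions of the record events of
  \<open>emeasure_record\<close>, over all discrete records, initial queues and arrivals. This
  avoids handling packets of random index directly.\<close>

lemma observations_measurable:
  assumes "\<nu> \<in> {enat c, \<infinity>}"
  shows "observations S n \<in> M \<rightarrow>\<^sub>M obs_measure \<mu> n"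
proof -
  have main: "{\<omega> \<in> space M. R (obs_U S k \<omega>) (obs_Y S k \<omega>) (obs_J S k \<omega>) \<and> obs_Z S k \<omega> \<in> A} \<in> events"
    if k: "k \<in> {1..n}" and A: "A \<in> sets (option_measure \<mu>)" for k A R
  proof -
    let ?K = "{1..n}"
    \<comment> \<open>Only slot \<open>k\<close> carries \<open>A\<close>; the measurements of the
      other slots range over the whole space.\<close>
    define W where "W u y j q a = {\<omega> \<in> start_event M S c q a. \<forall>i\<in>?K.
      obs_U S i \<omega> = u i \<and> obs_Y S i \<omega> = y i \<and> obs_J S i \<omega> = j i \<and>
      obs_Z S i \<omega> \<in> (if i = k then A else space (option_measure \<mu>))}" for u y j q a
    define J where "J u y = {j \<in> ?K \<rightarrow>\<^sub>E UNIV. R (u k) (y k) (j k)}" for u y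
    let ?E = "\<Union>u\<in>?K \<rightarrow>\<^sub>E UNIV. \<Union>y\<in>?K \<rightarrow>\<^sub>E UNIV. \<Union>j\<in>J u y. \<Union>q. \<Union>a. W u y j q a"
    have cnt: "countable (?K \<rightarrow>\<^sub>E (UNIV :: 'l option set))"
      "countable (?K \<rightarrow>\<^sub>E (UNIV :: bool option set))" "countable (?K \<rightarrow>\<^sub>E (UNIV :: nat option set))"
      by (intro countable_PiE; simp)+
    have cJ: "countable (J u y)" for u y
      using cnt(3) unfolding J_def by (rule countable_subset[rotated]) auto
    have "W u y j q a \<in> events" for u y j q a
      unfolding W_def by (rule emeasure_record(1)[OF assms]) (use A in auto)
    then have "?E \<in> events"
      by (intro sets.countable_UN'' cnt cJ) auto
    moreover have "{\<omega> \<in> space M. R (obs_U S k \<omega>) (obs_Y S k \<omega>) (obs_J S k \<omega>) \<and> obs_Z S k \<omega> \<in> A} = ?E"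
      (is "?L = _")
    proof (intro equalityI subsetI)
      fix \<omega> assume \<omega>: "\<omega> \<in> ?L"
      let ?u = "\<lambda>i\<in>?K. obs_U S i \<omega>" and ?y = "\<lambda>i\<in>?K. obs_Y S i \<omega>" and ?j = "\<lambda>i\<in>?K. obs_J S i \<omega>"
      have "\<omega> \<in> W ?u ?y ?j (init_queue S \<omega>) (arrivals S c \<omega>)"
        using \<omega> obs_Z_space[of \<omega>] by (simp add: W_def start_event_def)
      moreover have "?j \<in> J ?u ?y"
        using \<omega> k by (simp add: J_def)
      ultimately show "\<omega> \<in> ?E"
        by (intro UN_I[of ?u] UN_I[of ?y] UN_I[of ?j] UN_I[of "init_queue S \<omega>"] UN_I[of "arrivals S c \<omega>"])
          simp_all
    next
      fix \<omega> assume "\<omega> \<in> ?E"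
      then obtain u y j q a where "j \<in> J u y" and W: "\<omega> \<in> W u y j q a"
        by (elim UN_E)
      moreover have "obs_U S k \<omega> = u k \<and> obs_Y S k \<omega> = y k \<and> obs_J S k \<omega> = j k \<and> obs_Z S k \<omega> \<in> A"
        using W bspec[OF _ k, of "\<lambda>i. obs_U S i \<omega> = u i \<and> obs_Y S i \<omega> = y i \<and> obs_J S i \<omega> = j i \<and>
          obs_Z S i \<omega> \<in> (if i = k then A else space (option_measure \<mu>))"] by (simp add: W_def)
      moreover have "\<omega> \<in> space M"
        using W by (simp add: W_def start_event_def)
      ultimately show "\<omega> \<in> ?L"
        by (simp add: J_def)
    qed
    ultimately show ?thesis
      by simp
  qed
  have U: "obs_U S k \<in> M \<rightarrow>\<^sub>M count_space UNIV" and Y: "obs_Y S k \<in> M \<rightarrow>\<^sub>M count_space UNIV"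
    and J: "obs_J S k \<in> M \<rightarrow>\<^sub>M count_space UNIV" and Z: "obs_Z S k \<in> M \<rightarrow>\<^sub>M option_measure \<mu>"
    if k: "k \<in> {1..n}" for k
  proof -
    have Zsp: "{\<omega> \<in> space M. Q \<omega> \<and> obs_Z S k \<omega> \<in> space (option_measure \<mu>)} = Q -` {True} \<inter> space M" for Q
      using obs_Z_space k by auto
    note m = main[OF k sets.top, unfolded Zsp]
    show "obs_U S k \<in> M \<rightarrow>\<^sub>M count_space UNIV"
      unfolding measurable_count_space_eq_countable[OF countableI_type]
      using m[of "\<lambda>u _ _. u = _"] by (auto simp: vimage_def)
    show "obs_Y S k \<in> M \<rightarrow>\<^sub>M count_space UNIV"
      unfolding measurable_count_space_eq_countable[OF countableI_type]
      using m[of "\<lambda>_ y _. y = _"] by (auto simp: vimage_def)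
    show "obs_J S k \<in> M \<rightarrow>\<^sub>M count_space UNIV"
      unfolding measurable_count_space_eq_countable[OF countableI_type]
      using m[of "\<lambda>_ _ j. j = _"] by (auto simp: vimage_def)
    show "obs_Z S k \<in> M \<rightarrow>\<^sub>M option_measure \<mu>"
    proof (rule measurableI)
      fix A assume "A \<in> sets (option_measure \<mu>)"
      from main[OF k this, of "\<lambda>_ _ _. True"]
      show "obs_Z S k -` A \<inter> space M \<in> events"
        by (simp add: vimage_def Int_def conj_commute)
    qed (use obs_Z_space k in auto)
  qed
  show ?thesis
    unfolding observations_def obs_measure_def
    by (intro measurable_restrict measurable_Pair U Y J Z)
qed

text \<open>The probability depends on \<open>v\<close> only through its discrete components, a
  measurable map into a countable set.\<close>

lemma path_event_emeasure_measurable: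
  "(\<lambda>v. emeasure M (path_event M S c q a n (\<lambda>k\<in>{1..n}. fst (v k)) (\<lambda>k\<in>{1..n}. fst (snd (v k)))
       (\<lambda>k\<in>{1..n}. fst (snd (snd (v k)))))) \<in> borel_measurable (obs_measure \<mu> n)"
proof -
  let ?K = "{1..n}"
  let ?D = "\<lambda>v::nat \<Rightarrow> 'l option \<times> bool option \<times> nat option \<times> 'x option.
    (\<lambda>k\<in>?K. fst (v k), \<lambda>k\<in>?K. fst (snd (v k)), \<lambda>k\<in>?K. fst (snd (snd (v k))))"
  let ?V = "(?K \<rightarrow>\<^sub>E UNIV) \<times> (?K \<rightarrow>\<^sub>E UNIV) \<times> (?K \<rightarrow>\<^sub>E UNIV)
    :: ((nat \<Rightarrow> 'l option) \<times> (nat \<Rightarrow> bool option) \<times> (nat \<Rightarrow> nat option)) set"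
  have cV: "countable ?V"
    by (intro countable_SIGMA countable_PiE) auto
  have "?D \<in> obs_measure \<mu> n \<rightarrow>\<^sub>M count_space ?V"
    unfolding measurable_count_space_eq_countable[OF cV]
  proof (intro conjI ballI)
    fix d assume "d \<in> ?V"
    then obtain u y j where d: "d = (u, y, j)" "u \<in> extensional ?K" "y \<in> extensional ?K" "j \<in> extensional ?K"
      by (auto simp: PiE_iff)
    have bx: "record_box n u y j (\<lambda>_. space (option_measure \<mu>)) \<in> sets (obs_measure \<mu> n)"
      by (intro sets_record_box sets.top)
    have "?D -` {d} \<inter> space (obs_measure \<mu> n) = record_box n u y j (\<lambda>_. space (option_measure \<mu>))"
    proof (intro equalityI subsetI)
      fix v assume v: "v \<in> ?D -` {d} \<inter> space (obs_measure \<mu> n)"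
      then have v': "v \<in> extensional ?K" "\<And>k. k \<in> ?K \<Longrightarrow> v k \<in> space (slot_measure \<mu>)"
        by (auto simp: obs_measure_def space_PiM PiE_iff)
      have "u = (\<lambda>k\<in>?K. fst (v k))" "y = (\<lambda>k\<in>?K. fst (snd (v k)))" "j = (\<lambda>k\<in>?K. fst (snd (snd (v k))))"
        using v d(1) by auto
      then have "\<exists>z\<in>space (option_measure \<mu>). v k = (u k, y k, j k, z)" if "k \<in> ?K" for k
        using v'(2)[OF that] that by (cases "v k") (auto simp: space_pair_measure)
      with v'(1) show "v \<in> record_box n u y j (\<lambda>_. space (option_measure \<mu>))"
        by (simp add: mem_record_box)
    next
      fix v assume v: "v \<in> record_box n u y j (\<lambda>_. space (option_measure \<mu>))"
      have "v \<in> space (obs_measure \<mu> n)"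
        using sets.sets_into_space[OF bx] v by blast
      with restrict_record_box[OF v d(2-)] d(1) show "v \<in> ?D -` {d} \<inter> space (obs_measure \<mu> n)"
        by simp
    qed
    then show "?D -` {d} \<inter> space (obs_measure \<mu> n) \<in> sets (obs_measure \<mu> n)"
      using bx by simp
  qed auto
  then have "(\<lambda>v. (\<lambda>(u, y, j). emeasure M (path_event M S c q a n u y j)) (?D v)) \<in> borel_measurable (obs_measure \<mu> n)"
    by (rule measurable_compose) simp
  then show ?thesis
    by (simp only: prod.case)
qed

lemma obs_density_measurable:
  assumes "\<nu> \<in> {enat c, \<infinity>}"
  shows "obs_density \<nu> f\<^sub>0 f\<^sub>1 p\<^sub>0 p\<^sub>1 M S c q a n \<in> borel_measurable (obs_measure \<mu> n)"
proof -
  have "(\<lambda>v. \<Prod>k\<in>{1..n}. slot_density \<nu> f\<^sub>0 f\<^sub>1 p\<^sub>0 p\<^sub>1 q a k (v k)) \<in> borel_measurable (obs_measure \<mu> n)"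
    unfolding obs_measure_def
    by (intro borel_measurable_prod_ennreal measurable_compose[OF _ slot_density_measurable[OF assms]]
        measurable_component_singleton)
  then show ?thesis
    unfolding obs_density_def
    by (intro borel_measurable_times_ennreal borel_measurable_divide_ennreal
        path_event_emeasure_measurable) auto
qed

text \<open>By \<open>obs_measure_eqI\<close> record boxes suffice. There the discrete components
  are constant, so the path probability leaves the integral and the rest factorizes over slots into
  the product of \<open>emeasure_record\<close>.\<close>

lemma distr_observations:
  assumes \<nu>: "\<nu> \<in> {enat c, \<infinity>}" and sf: "sigma_finite_measure \<mu>"
    and B: "emeasure M (start_event M S c q a) \<noteq> 0"
  shows "distr (uniform_measure M (start_event M S c q a)) (obs_measure \<mu> n) (observations S n) =
    density (obs_measure \<mu> n) (obs_density \<nu> f\<^sub>0 f\<^sub>1 p\<^sub>0 p\<^sub>1 M S c q a n)"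
    (is "?P = ?Q")
proof (rule obs_measure_eqI)
  let ?B = "start_event M S c q a"
  have obsM: "observations S n \<in> uniform_measure M ?B \<rightarrow>\<^sub>M obs_measure \<mu> n"
    using observations_measurable[OF \<nu>] by simp
  interpret U: prob_space "uniform_measure M ?B"
    using B by (intro prob_space_uniform_measure) auto
  show "finite_measure ?P"
    using U.prob_space_distr[OF obsM] by (rule prob_space.finite_measure)
  fix u :: "nat \<Rightarrow> 'l option" and y :: "nat \<Rightarrow> bool option" and j :: "nat \<Rightarrow> nat option"
    and A :: "nat \<Rightarrow> 'x option set"
  assume ext: "u \<in> extensional {1..n}" "y \<in> extensional {1..n}" "j \<in> extensional {1..n}"
    and A: "\<And>k. k \<in> {1..n} \<Longrightarrow> A k \<in> sets (option_measure \<mu>)"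
  let ?G = "emeasure M (path_event M S c q a n u y j)"
  let ?s = "slot_density \<nu> f\<^sub>0 f\<^sub>1 p\<^sub>0 p\<^sub>1 q a"
  let ?\<zeta> = "\<lambda>k. case u k of None \<Rightarrow> indicator (A k) None
      | Some l \<Rightarrow> (\<integral>\<^sup>+x. packet_density \<nu> f\<^sub>0 f\<^sub>1 q a l (the (j k)) x * indicator (Some -` A k) x \<partial>\<mu>)"
  let ?\<kappa> = "\<Prod>k\<in>{1..n}. channel_density \<nu> p\<^sub>0 p\<^sub>1 k (y k) * ?\<zeta> k"
  have mult_div: "x * z / w = x / w * z" for x z w :: ennreal
    by (simp add: divide_ennreal_def ac_simps)
  have box: "record_box n u y j A \<in> sets (obs_measure \<mu> n)"
    by (intro sets_record_box A)
  have eq: "?B \<inter> (observations S n -` record_box n u y j A \<inter> space M) = {\<omega> \<in> ?B. \<forall>k\<in>{1..n}.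
      obs_U S k \<omega> = u k \<and> obs_Y S k \<omega> = y k \<and> obs_J S k \<omega> = j k \<and> obs_Z S k \<omega> \<in> A k}"
    by (auto simp: mem_record_box observations_def start_event_def)
  have "emeasure ?P (record_box n u y j A) = emeasure M (?B \<inter> (observations S n -` record_box n u y j A \<inter> space M)) / emeasure M ?B"
    using box observations_measurable[OF \<nu>] start_event_events
    by (simp add: emeasure_distr[OF obsM])
  also have "\<dots> = ?G * ?\<kappa> / emeasure M ?B"
    unfolding eq using emeasure_record(2)[OF \<nu> A] by simp
  also have "\<dots> = ?G / emeasure M ?B * ?\<kappa>"
    by (rule mult_div)
  finally have P: "emeasure ?P (record_box n u y j A) = ?G / emeasure M ?B * ?\<kappa>" .
  interpret ps: product_sigma_finite "\<lambda>_::nat. slot_measure \<mu> :: ('l option \<times> _) measure"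
    using sigma_finite_slot_measure[OF sf] by (simp add: product_sigma_finite_def)
  have s_meas: "(\<lambda>w. ?s k w * indicator ({u k} \<times> {y k} \<times> {j k} \<times> A k) w) \<in> borel_measurable (slot_measure \<mu>)"
    if "k \<in> {1..n}" for k
    by (intro borel_measurable_times_ennreal slot_density_measurable[OF \<nu>] borel_measurable_indicator
        pair_measureI A that) auto
  have "emeasure ?Q (record_box n u y j A) =
      (\<integral>\<^sup>+v. obs_density \<nu> f\<^sub>0 f\<^sub>1 p\<^sub>0 p\<^sub>1 M S c q a n v * indicator (record_box n u y j A) v \<partial>obs_measure \<mu> n)"
    by (rule emeasure_density[OF obs_density_measurable[OF \<nu>] box])
  also have "\<dots> = (\<integral>\<^sup>+v. ?G / emeasure M ?B *
      (\<Prod>k\<in>{1..n}. ?s k (v k) * indicator ({u k} \<times> {y k} \<times> {j k} \<times> A k) (v k)) \<partial>obs_measure \<mu> n)"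
  proof (rule nn_integral_cong)
    fix v :: "nat \<Rightarrow> 'l option \<times> bool option \<times> nat option \<times> 'x option"
    assume v: "v \<in> space (obs_measure \<mu> n)"
    show "obs_density \<nu> f\<^sub>0 f\<^sub>1 p\<^sub>0 p\<^sub>1 M S c q a n v * indicator (record_box n u y j A) v =
      ?G / emeasure M ?B * (\<Prod>k\<in>{1..n}. ?s k (v k) * indicator ({u k} \<times> {y k} \<times> {j k} \<times> A k) (v k))"
    proof (cases "v \<in> record_box n u y j A")
      case True
      then have "v k \<in> {u k} \<times> {y k} \<times> {j k} \<times> A k" if "k \<in> {1..n}" for k
        using that unfolding record_box_def by (rule PiE_mem)
      then have "(\<Prod>k\<in>{1..n}. ?s k (v k) * indicator ({u k} \<times> {y k} \<times> {j k} \<times> A k) (v k)) =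
        (\<Prod>k\<in>{1..n}. ?s k (v k))"
        by (intro prod.cong refl) (simp only: indicator_simps mult_1_right)
      then show ?thesis
        using True unfolding obs_density_def restrict_record_box[OF True ext] by simp
    next
      case False
      moreover have "v \<in> extensional {1..n}"
        using v by (auto simp: obs_measure_def space_PiM PiE_iff)
      ultimately obtain k where k: "k \<in> {1..n}" "v k \<notin> {u k} \<times> {y k} \<times> {j k} \<times> A k"
        unfolding record_box_def PiE_iff by blast
      then have "?s k (v k) * indicator ({u k} \<times> {y k} \<times> {j k} \<times> A k) (v k) = 0"
        by (simp only: indicator_simps mult_zero_right not_False_eq_True)
      then have "(\<Prod>k\<in>{1..n}. ?s k (v k) * indicator ({u k} \<times> {y k} \<times> {j k} \<times> A k) (v k)) = 0"
        using k(1) by (intro prod_zero) auto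
      with False show ?thesis
        by simp
    qed
  qed
  also have "\<dots> = ?G / emeasure M ?B * (\<integral>\<^sup>+v. (\<Prod>k\<in>{1..n}. ?s k (v k) *
      indicator ({u k} \<times> {y k} \<times> {j k} \<times> A k) (v k)) \<partial>obs_measure \<mu> n)"
    unfolding obs_measure_def
    by (intro nn_integral_cmult borel_measurable_prod_ennreal measurable_compose[OF _ s_meas]
        measurable_component_singleton)
  also have "(\<integral>\<^sup>+v. (\<Prod>k\<in>{1..n}. ?s k (v k) *
      indicator ({u k} \<times> {y k} \<times> {j k} \<times> A k) (v k)) \<partial>obs_measure \<mu> n) =
      (\<Prod>k\<in>{1..n}. \<integral>\<^sup>+w. ?s k w * indicator ({u k} \<times> {y k} \<times> {j k} \<times> A k) w \<partial>slot_measure \<mu>)"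
    unfolding obs_measure_def
    by (intro ps.product_nn_integral_prod s_meas finite_atLeastAtMost)
  also have "\<dots> = ?\<kappa>"
    by (intro prod.cong refl nn_integral_slot_density[OF \<nu> sf] A)
  finally show "emeasure ?P (record_box n u y j A) = emeasure ?Q (record_box n u y j A)"
    unfolding P by simp
qed simp_all

section \<open>The likelihood ratio\<close>

text \<open>There are countably many pairs \<open>(q, a)\<close>, so the start events of probability
  0 together form a null set.\<close>

lemma AE_start_event:
  "AE \<omega> in M. emeasure M (start_event M S c (init_queue S \<omega>) (arrivals S c \<omega>)) \<noteq> 0"
proof -
  have "AE \<omega> in M. \<forall>q a. emeasure M (start_event M S c q a) = 0 \<longrightarrow> \<omega> \<notin> start_event M S c q a"
    unfolding AE_all_countable
  proof (intro allI)
    fix q a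
    show "AE \<omega> in M. emeasure M (start_event M S c q a) = 0 \<longrightarrow> \<omega> \<notin> start_event M S c q a"
      by (cases "emeasure M (start_event M S c q a) = 0")
        (simp_all add: AE_not_in null_setsI start_event_events)
  qed
  then show ?thesis
    by (rule AE_mp) (auto simp: start_event_def intro!: AE_I2)
qed

text \<open>Given a start event of positive probability, the observations have a density for
  \<open>obs_measure\<close>; so its null sets are null for them, and the density is almost surely
  positive under its own law. Countability of the pairs \<open>(q, a)\<close> allows inserting the
  realised one.\<close>

lemma AE_observations:
  assumes \<nu>: "\<nu> \<in> {enat c, \<infinity>}" and sf: "sigma_finite_measure \<mu>"
    and P: "\<And>q a. AE v in obs_measure \<mu> n. P q a v"
  shows "AE \<omega> in M. P (init_queue S \<omega>) (arrivals S c \<omega>) (observations S n \<omega>) \<and>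
    0 < obs_density \<nu> f\<^sub>0 f\<^sub>1 p\<^sub>0 p\<^sub>1 M S c (init_queue S \<omega>) (arrivals S c \<omega>) n (observations S n \<omega>)"
proof -
  let ?h = "obs_density \<nu> f\<^sub>0 f\<^sub>1 p\<^sub>0 p\<^sub>1 M S c"
  have "AE \<omega> in M. \<forall>q a. \<omega> \<in> start_event M S c q a \<longrightarrow>
    P q a (observations S n \<omega>) \<and> 0 < ?h q a n (observations S n \<omega>)"
    unfolding AE_all_countable
  proof (intro allI)
    fix q a
    let ?B = "start_event M S c q a"
    show "AE \<omega> in M. \<omega> \<in> ?B \<longrightarrow> P q a (observations S n \<omega>) \<and> 0 < ?h q a n (observations S n \<omega>)"
    proof (cases "emeasure M ?B = 0")
      case True
      then have "AE \<omega> in M. \<omega> \<notin> ?B"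
        by (simp add: AE_not_in null_setsI start_event_events)
      then show ?thesis
        by (rule AE_mp) auto
    next
      case False
      have "AE v in density (obs_measure \<mu> n) (?h q a n). P q a v \<and> 0 < ?h q a n v"
        unfolding AE_density[OF obs_density_measurable[OF \<nu>]] using P[of q a] by (rule AE_mp) auto
      then have "AE v in distr (uniform_measure M ?B) (obs_measure \<mu> n) (observations S n).
          P q a v \<and> 0 < ?h q a n v"
        unfolding distr_observations[OF \<nu> sf False] .
      then have "AE \<omega> in uniform_measure M ?B. P q a (observations S n \<omega>) \<and> 0 < ?h q a n (observations S n \<omega>)"
        by (rule AE_distrD[rotated]) (use observations_measurable[OF \<nu>] in simp)
      then show ?thesis
        by (subst (asm) AE_uniform_measure) (use False in \<open>simp_all add: less_top[symmetric]\<close>)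
    qed
  qed
  then show ?thesis
    by (rule AE_mp) (auto simp: start_event_def intro!: AE_I2)
qed

lemma AE_distributed:
  assumes "distributed M \<mu> X f" "AE x in \<mu>. P x"
  shows "AE \<omega> in M. P (X \<omega>)"
proof -
  have "AE x in density \<mu> f. P x"
    unfolding AE_density[OF distributed_borel_measurable[OF assms(1)]] using assms(2) by (rule AE_mp) auto
  then have "AE x in distr M \<mu> X. P x"
    unfolding distributed_distr_eq_density[OF assms(1)] .
  then show ?thesis
    by (rule AE_distrD[OF distributed_measurable[OF assms(1)]])
qed

lemma AE_distributed_density_finite:
  assumes "distributed M \<mu> X f"
  shows "AE x in \<mu>. f x \<noteq> top"
proof -
  have "(\<integral>\<^sup>+x. f x \<partial>\<mu>) = (\<integral>\<^sup>+x. f x * indicator (space \<mu>) x \<partial>\<mu>)"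
    by (intro nn_integral_cong) auto
  also have "\<dots> = emeasure M (X -` space \<mu> \<inter> space M)"
    using distributed_emeasure[OF assms] by auto
  finally have "(\<integral>\<^sup>+x. f x \<partial>\<mu>) \<noteq> \<infinity>"
    by simp
  then show ?thesis
    using nn_integral_PInf_AE[OF distributed_borel_measurable[OF assms]] by simp
qed

text \<open>The source of a delivered packet is random, so the property is secured for all of the
  countably many readings at once.\<close>

lemma AE_packet:
  assumes "AE x in \<mu>. P x"
  shows "AE \<omega> in M. \<forall>k l. 1 \<le> k \<longrightarrow> obs_U S k \<omega> = Some l \<longrightarrow> P (packet S (the (obs_J S k \<omega>)) l \<omega>)"
proof -
  have "AE \<omega> in M. \<forall>j l. 1 \<le> j \<longrightarrow> P (init_reading S j l \<omega>)"
    unfolding AE_all_countable using AE_distributed[OF init_reading_law assms] by auto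
  moreover have "AE \<omega> in M. \<forall>k l. 1 \<le> k \<longrightarrow> P (reading S k l \<omega>)"
    unfolding AE_all_countable using AE_distributed[OF reading_law assms] by auto
  moreover have "AE \<omega> in M. \<omega> \<in> space M"
    by (rule AE_space)
  ultimately show ?thesis
  proof eventually_elim
    case (elim \<omega>)
    show ?case
    proof (intro allI impI)
      fix k l assume k: "1 \<le> k" "obs_U S k \<omega> = Some l"
      show "P (packet S (the (obs_J S k \<omega>)) l \<omega>)"
        using delivered_packet_source[OF elim(3) k] elim(1,2)
        by (cases "packet_source S (delivered S k \<omega> l) l \<omega>")
          (auto simp: sources_def packet_eq_source_reading obs_J_eq k(2))
    qed
  qed
qed

lemma AE_init_queue: "AE \<omega> in M. pmf \<pi> (init_queue S \<omega>) \<noteq> 0"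
proof -
  have "AE q in measure_pmf \<pi>. pmf \<pi> q \<noteq> 0"
    by (simp add: AE_measure_pmf_iff set_pmf_iff)
  then show ?thesis
    unfolding init_law[symmetric] by (rule AE_distrD[OF init_measurable])
qed

section \<open>Channel outcomes in busy slots\<close>

lemma busy_saturated:
  assumes "1 \<le> k" "0 < norm0 (queue S k \<omega>)"
    and "\<forall>s\<in>base_sources (k - 1) \<union> Channel ` {1..k - 1}. source_val S s \<omega> = source_val S s \<omega>'"
  shows "0 < norm0 (queue S k \<omega>')"
proof -
  have "agree_upto (k - 1) S \<omega> S \<omega>'"
    using assms(3) unfolding agree_upto_iff_source_val by blast
  moreover have "channel S i \<omega> = channel S i \<omega>'" if "1 \<le> i" "i < k" for i
  proof -
    have "Channel i \<in> base_sources (k - 1) \<union> Channel ` {1..k - 1}"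
      using that by auto
    with assms(3) have "source_val S (Channel i) \<omega> = source_val S (Channel i) \<omega>'"
      by blast
    then show ?thesis
      by simp
  qed
  ultimately have "queue S k \<omega> = queue S k \<omega>'"
    by (intro queue_cong) auto
  with assms(2) show ?thesis
    by simp
qed

text \<open>Base sources and channels of earlier slots decide whether slot \<open>k\<close> is busy,
  so \<open>Channel k\<close> is independent of that event.\<close>

lemma busy_event:
  assumes k: "1 \<le> k"
  shows "{\<omega> \<in> space M. 0 < norm0 (queue S k \<omega>)} \<in> events"
    and "{\<omega> \<in> space M. 0 < norm0 (queue S k \<omega>) \<and> channel S k \<omega> = b} \<in> events"
    and "emeasure M {\<omega> \<in> space M. 0 < norm0 (queue S k \<omega>) \<and> channel S k \<omega> = b} =
      emeasure M {\<omega> \<in> space M. 0 < norm0 (queue S k \<omega>)} * channel_density \<nu> p\<^sub>0 p\<^sub>1 k (Some b)"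
proof -
  let ?I = "base_sources (k - 1) \<union> Channel ` {1..k - 1} :: 'l source set"
  let ?E = "{\<omega> \<in> space M. 0 < norm0 (queue S k \<omega>)}"
  have I: "finite ?I" "?I \<subseteq> sources" "\<And>s. s \<in> ?I \<Longrightarrow> \<not> is_reading s" and kI: "Channel k \<notin> ?I"
    using finite_base_sources base_sources_subset[of "k - 1"] k by (auto simp: sources_def)
  have ES: "?E \<subseteq> space M"
    by auto
  have sat: "\<omega>' \<in> ?E" if "\<omega> \<in> ?E" "\<omega>' \<in> space M" "\<forall>s\<in>?I. source_val S s \<omega> = source_val S s \<omega>'" for \<omega> \<omega>'
    using busy_saturated[OF k _ that(3)] that by simp
  have kS: "Channel k \<in> sources"
    using k by (auto simp: sources_def)
  have indep: "\<exists>J P. finite J \<and> J \<subseteq> sources - ?I \<and>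
      (\<forall>s\<in>J. {\<omega> \<in> space M. P s \<omega>} \<in> source_events M \<mu> S s) \<and>
      (\<forall>\<omega>\<in>space M. (\<forall>s\<in>?I. source_val S s \<omega>0 = source_val S s \<omega>) \<longrightarrow> (channel S k \<omega> = b) = (\<forall>s\<in>J. P s \<omega>)) \<and>
      (\<Prod>s\<in>J. emeasure M {\<omega> \<in> space M. P s \<omega>}) = channel_density \<nu> p\<^sub>0 p\<^sub>1 k (Some b)" for \<omega>0
    by (rule exI[of _ "{Channel k}"], rule exI[of _ "\<lambda>_ \<omega>. channel S k \<omega> = b"])
      (use kS kI channel_event[of k b] emeasure_channel[OF k, of b] in
        \<open>simp add: channel_density_def del: source_events.simps\<close>)
  have eq: "{\<omega> \<in> ?E. channel S k \<omega> = b} = {\<omega> \<in> space M. 0 < norm0 (queue S k \<omega>) \<and> channel S k \<omega> = b}"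
    by auto
  note * = emeasure_saturated[OF I ES sat indep]
  show "?E \<in> events"
    by (rule *(2))
  show "{\<omega> \<in> space M. 0 < norm0 (queue S k \<omega>) \<and> channel S k \<omega> = b} \<in> events"
    using *(1) unfolding eq .
  show "emeasure M {\<omega> \<in> space M. 0 < norm0 (queue S k \<omega>) \<and> channel S k \<omega> = b} =
      emeasure M ?E * channel_density \<nu> p\<^sub>0 p\<^sub>1 k (Some b)"
    using *(3) unfolding eq .
qed

text \<open>In slot 1 the initial queue of \<omega> itself has positive mass; later, a sample in
  slot \<open>k - 1\<close>, of probability \<open>r\<close>, leaves a queue non-empty. The
  assumptions on \<omega> do not involve \<open>M\<close>, so one outcome serves both laws.\<close>

lemma busy_emeasure_pos:
  assumes k: "1 \<le> k" and r: "0 < r" "r < 1"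
    and \<omega>: "pmf \<pi> (init_queue S \<omega>) \<noteq> 0" "0 < norm0 (queue S k \<omega>)"
  shows "emeasure M {\<omega> \<in> space M. 0 < norm0 (queue S k \<omega>)} \<noteq> 0"
proof (cases "k = 1")
  case True
  let ?q = "init_queue S \<omega>"
  have "emeasure (measure_pmf \<pi>) {?q} = emeasure M (init_queue S -` {?q} \<inter> space M)"
    unfolding init_law[symmetric] by (intro emeasure_distr init_measurable) simp
  also have "\<dots> \<le> emeasure M {\<omega> \<in> space M. 0 < norm0 (queue S k \<omega>)}"
    by (intro emeasure_mono busy_event k) (use True \<omega>(2) in auto)
  finally show ?thesis
    using \<omega>(1) by (auto simp: emeasure_pmf_single)
next
  case False
  then obtain i where i: "k = Suc (Suc i)"
    using k by (metis One_nat_def le_0_eq not0_implies_Suc numeral_nat(7) zero_neq_one)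
  fix l :: 'l
  have "emeasure (measure_pmf (bernoulli_pmf r)) {True} = emeasure M (sampled S (Suc i) l -` {True} \<inter> space M)"
    using sampled_law[of "Suc i" l] sampled_measurable[of "Suc i" l]
    by (metis (no_types) UNIV_I emeasure_distr le_add1 plus_1_eq_Suc sets_count_space Pow_UNIV)
  also have "\<dots> \<le> emeasure M {\<omega> \<in> space M. 0 < norm0 (queue S k \<omega>)}"
  proof (intro emeasure_mono busy_event k subsetI)
    fix \<omega>' assume "\<omega>' \<in> sampled S (Suc i) l -` {True} \<inter> space M"
    then have "l \<in> support (queue S k \<omega>')" "\<omega>' \<in> space M"
      by (auto simp: i support_def Let_def)
    then show "\<omega>' \<in> {\<omega> \<in> space M. 0 < norm0 (queue S k \<omega>)}"
      by (auto simp: norm0_pos_iff)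
  qed
  finally show ?thesis
    using r by (auto simp: emeasure_pmf_single)
qed

lemma channel_likelihood_eq:
  assumes k: "1 \<le> k" and r: "0 < r" "r < 1"
    and \<omega>: "pmf \<pi> (init_queue S \<omega>) \<noteq> 0" "0 < norm0 (queue S k \<omega>)"
  shows "channel_likelihood M S k \<omega> = channel_density \<nu> p\<^sub>0 p\<^sub>1 k (obs_Y S k \<omega>)"
proof -
  let ?E = "{\<omega> \<in> space M. 0 < norm0 (queue S k \<omega>)}"
  define b where "b = channel S k \<omega>"
  have Y: "obs_Y S k \<omega> = Some b"
    using \<omega>(2) by (simp add: obs_Y_def b_def)
  have eq: "{\<omega>' \<in> space M. obs_Y S k \<omega>' = obs_Y S k \<omega> \<and> 0 < norm0 (queue S k \<omega>')} =
    {\<omega> \<in> space M. 0 < norm0 (queue S k \<omega>) \<and> channel S k \<omega> = b}"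
    unfolding Y by (auto simp: obs_Y_def)
  obtain d where d: "channel_density \<nu> p\<^sub>0 p\<^sub>1 k (Some b) = ennreal d" "0 \<le> d"
    by (auto simp: channel_density_def)
  have "ennreal (prob {\<omega> \<in> space M. 0 < norm0 (queue S k \<omega>) \<and> channel S k \<omega> = b}) = ennreal (prob ?E * d)"
    using busy_event(3)[OF k, of b] d by (simp add: emeasure_eq_measure ennreal_mult)
  then have "prob {\<omega> \<in> space M. 0 < norm0 (queue S k \<omega>) \<and> channel S k \<omega> = b} = prob ?E * d"
    using d(2) by (simp add: ennreal_inj)
  moreover have "prob ?E \<noteq> 0"
    using busy_emeasure_pos[OF k r \<omega>] by (simp add: emeasure_eq_measure)
  ultimately show ?thesis
    unfolding channel_likelihood_def cond_prob_def eq unfolding Y d(1) by simp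
qed

end

lemma obs_density_observations:
  "obs_density \<rho> f\<^sub>0 f\<^sub>1 p\<^sub>0 p\<^sub>1 M S c q a n (observations S n \<omega>) =
    emeasure M (path_event M S c q a n (\<lambda>k\<in>{1..n}. obs_U S k \<omega>) (\<lambda>k\<in>{1..n}. obs_Y S k \<omega>)
      (\<lambda>k\<in>{1..n}. obs_J S k \<omega>)) / emeasure M (start_event M S c q a) *
    (\<Prod>k\<in>{1..n}. channel_density \<rho> p\<^sub>0 p\<^sub>1 k (obs_Y S k \<omega>) *
      reading_density \<rho> f\<^sub>0 f\<^sub>1 q a (obs_U S k \<omega>) (obs_J S k \<omega>) (obs_Z S k \<omega>))"
  unfolding obs_density_def observations_def
  by (simp add: slot_density_def cong: restrict_cong)

text \<open>Ratios may be 0 or \<open>top\<close>, but by \<open>pos\<close> not both kinds occur: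
  positive numerators make all of them nonzero, positive denominators make all of them finite. So
  \<open>eln\<close> is additive throughout.\<close>

lemma eln_likelihood_ratio:
  fixes g :: ennreal and c d f h :: "nat \<Rightarrow> ennreal"
  assumes g: "g \<noteq> 0" "g \<noteq> top"
    and fin: "\<And>k. k \<in> I \<Longrightarrow> c k \<noteq> top \<and> d k \<noteq> top \<and> f k \<noteq> top \<and> h k \<noteq> top"
    and pos: "(\<forall>k\<in>I. c k \<noteq> 0 \<and> f k \<noteq> 0) \<or> (\<forall>k\<in>I. d k \<noteq> 0 \<and> h k \<noteq> 0)"
    and I: "finite I"
  shows "eln ((g * (\<Prod>k\<in>I. c k * f k)) / (g * (\<Prod>k\<in>I. d k * h k))) =
    (\<Sum>k\<in>I. eln (c k / d k) + eln (f k / h k))"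
proof -
  have dh: "d k * h k \<noteq> top" if "k \<in> I" for k
    using fin[OF that] by (simp add: ennreal_mult_eq_top_iff)
  then have "(\<Prod>k\<in>I. d k * h k) \<noteq> top"
    by (simp add: ennreal_prod_eq_top)
  then have "(g * (\<Prod>k\<in>I. c k * f k)) / (g * (\<Prod>k\<in>I. d k * h k)) =
      (\<Prod>k\<in>I. c k * f k) / (\<Prod>k\<in>I. d k * h k)"
    using g by (simp add: ennreal_mult_divide_mult ennreal_divide_self less_top)
  also have "\<dots> = (\<Prod>k\<in>I. (c k * f k) / (d k * h k))"
    by (intro ennreal_prod_divide_prod I dh)
  also have "\<dots> = (\<Prod>k\<in>I. (c k / d k) * (f k / h k))"
    using fin by (intro prod.cong refl ennreal_mult_divide_mult) auto
  finally have ratio: "(g * (\<Prod>k\<in>I. c k * f k)) / (g * (\<Prod>k\<in>I. d k * h k)) = (\<Prod>k\<in>I. (c k / d k) * (f k / h k))" .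
  have cases: "(\<forall>k\<in>I. c k / d k \<noteq> top \<and> f k / h k \<noteq> top) \<or> (\<forall>k\<in>I. c k / d k \<noteq> 0 \<and> f k / h k \<noteq> 0)"
    using pos fin by (auto simp: ennreal_divide_eq_top_iff ennreal_divide_eq_0_iff)
  have "eln (\<Prod>k\<in>I. (c k / d k) * (f k / h k)) = (\<Sum>k\<in>I. eln ((c k / d k) * (f k / h k)))"
    using cases by (intro eln_prod I) (auto simp: ennreal_mult_eq_top_iff)
  also have "\<dots> = (\<Sum>k\<in>I. eln (c k / d k) + eln (f k / h k))"
    using cases by (intro sum.cong refl eln_mult) auto
  finally show ?thesis
    unfolding ratio .
qed

theorem proposition2:
  fixes Pr :: "enat \<Rightarrow> 'w measure"
    and \<mu> :: "'x measure" and f\<^sub>0 f\<^sub>1 :: "'x \<Rightarrow> ennreal"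
    and \<pi> :: "('l::finite \<Rightarrow> nat) pmf" and r p\<^sub>0 p\<^sub>1 :: real
    and S :: "('w, 'l, 'x) sensor_system" and \<nu> n :: nat
  assumes "0 < r" and "r < 1" and "p\<^sub>0 \<le> 1" and "p\<^sub>1 \<le> 1"
    and "real CARD('l) * r < min p\<^sub>0 p\<^sub>1"
    and "sigma_finite_measure \<mu>"
    and "\<And>\<nu>'. sets (Pr \<nu>') = sets (Pr \<infinity>)"
    and "\<And>\<nu>'. sensor_law (Pr \<nu>') \<nu>' \<mu> f\<^sub>0 f\<^sub>1 \<pi> r p\<^sub>0 p\<^sub>1 S"
  shows "\<forall>\<nu>'\<in>{enat \<nu>, \<infinity>}. AE \<omega> in Pr \<nu>'.
    log_likelihood_ratio Pr \<mu> S \<nu> n \<omega> =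
      (\<Sum>k=1..n.
         (if norm0 (queue S k \<omega>) > 0
          then eln (channel_likelihood (Pr (enat \<nu>)) S k \<omega> / channel_likelihood (Pr \<infinity>) S k \<omega>)
          else 0) +
         (if obs_Y S k \<omega> = Some True \<and>
             the (obs_J S k \<omega>) > init_queue S \<omega> (the (obs_U S k \<omega>))
               + arrivals S \<nu> \<omega> (the (obs_U S k \<omega>))
          then eln (f\<^sub>1 (packet S (the (obs_J S k \<omega>)) (the (obs_U S k \<omega>)) \<omega>) /
                    f\<^sub>0 (packet S (the (obs_J S k \<omega>)) (the (obs_U S k \<omega>)) \<omega>))
          else 0))"
proof (rule ballI)
  fix \<nu>' assume \<nu>': "\<nu>' \<in> {enat \<nu>, \<infinity>}"
  note r = assms(1,2) and sf = assms(6) and law = assms(8)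
  have space: "space (Pr \<rho>) = space (Pr \<infinity>)" for \<rho>
    by (rule sets_eq_imp_space_eq) (rule assms(7))
  let ?N = "obs_measure \<mu> n :: (nat \<Rightarrow> 'l option \<times> bool option \<times> nat option \<times> 'x option) measure"
  let ?h = "\<lambda>\<rho>. obs_density \<rho> f\<^sub>0 f\<^sub>1 p\<^sub>0 p\<^sub>1 (Pr \<rho>) S \<nu>"
  define B where "B q a = start_event (Pr \<infinity>) S \<nu> q a" for q a
  have B: "start_event (Pr \<rho>) S \<nu> q a = B q a" for \<rho> q a
    by (simp add: B_def start_event_def space[of \<rho>])
  have path: "path_event (Pr \<rho>) S \<nu> q a n u y j = path_event (Pr \<infinity>) S \<nu> q a n u y j" for \<rho> q a n u y j
    by (simp add: path_event_def B)
  have inv: "emeasure (Pr \<rho>) (path_event (Pr \<infinity>) S \<nu> q a n u y j) =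
      emeasure (Pr \<nu>') (path_event (Pr \<infinity>) S \<nu> q a n u y j)" for \<rho> q a n u y j
  proof (rule emeasure_base_invariant[OF law law])
    show "space (Pr \<nu>') = space (Pr \<rho>)"
      by (simp add: space[of \<nu>'] space[of \<rho>])
    show "path_event (Pr \<infinity>) S \<nu> q a n u y j \<subseteq> space (Pr \<rho>)"
      using path_event_subset by (simp add: space[of \<rho>])
    show "\<omega>' \<in> path_event (Pr \<infinity>) S \<nu> q a n u y j"
      if "\<omega> \<in> path_event (Pr \<infinity>) S \<nu> q a n u y j" "\<omega>' \<in> space (Pr \<rho>)" "agree_upto (max n \<nu>) S \<omega> S \<omega>'" for \<omega> \<omega>'
      using path_event_saturated[OF that(1) _ that(3)] that(2) by (simp add: space[of \<rho>])
  qed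
  have Binv: "emeasure (Pr \<rho>) (B q a) = emeasure (Pr \<nu>') (B q a)" for \<rho> q a
    using inv[of \<rho> q a 0] by (simp add: path_event_0 B_def)
  interpret L: sensor_law "Pr \<nu>'" \<nu>' \<mu> f\<^sub>0 f\<^sub>1 \<pi> r p\<^sub>0 p\<^sub>1 S
    by (rule law)
  \<comment> \<open>The guard excludes conditioning on a null event; by \<open>Binv\<close> it means
    the same under both laws.\<close>
  have RN: "AE v in ?N. emeasure (Pr \<nu>') (B q a) \<noteq> 0 \<longrightarrow>
      ?h \<rho> q a n v = RN_deriv ?N (distr (uniform_measure (Pr \<rho>) (B q a)) ?N (observations S n)) v"
    if \<rho>: "\<rho> \<in> {enat \<nu>, \<infinity>}" for \<rho> q a
  proof (cases "emeasure (Pr \<nu>') (B q a) = 0")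
    case False
    interpret R: sensor_law "Pr \<rho>" \<rho> \<mu> f\<^sub>0 f\<^sub>1 \<pi> r p\<^sub>0 p\<^sub>1 S
      by (rule law)
    have "emeasure (Pr \<rho>) (start_event (Pr \<rho>) S \<nu> q a) \<noteq> 0"
      using False by (simp add: B Binv[of \<rho>])
    from R.distr_observations[OF \<rho> sf this, of n, symmetric]
    have "AE v in ?N. ?h \<rho> q a n v = RN_deriv ?N (distr (uniform_measure (Pr \<rho>) (B q a)) ?N (observations S n)) v"
      unfolding B by (rule sigma_finite_measure.RN_deriv_unique[OF sigma_finite_obs_measure[OF sf]
          R.obs_density_measurable[OF \<rho>]])
    then show ?thesis
      by (rule AE_mp) auto
  qed simp
  \<comment> \<open>Both laws enter one predicate, since both likelihoods are evaluated at an
    observation drawn from \<open>Pr \<nu>'\<close> alone.\<close>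
  define good where "good q a v \<longleftrightarrow> (\<forall>\<rho>\<in>{enat \<nu>, \<infinity>}. emeasure (Pr \<nu>') (B q a) \<noteq> 0 \<longrightarrow>
      ?h \<rho> q a n v = RN_deriv ?N (distr (uniform_measure (Pr \<rho>) (B q a)) ?N (observations S n)) v)"
    for q a v
  have "AE v in ?N. good q a v" for q a
    unfolding good_def using RN by (intro AE_finite_allI) auto
  note obs = L.AE_observations[OF \<nu>' sf, where P = good and n = n, OF this]
  \<comment> \<open>Under \<open>Pr 0\<close> slot 1 already lies after the change, so a reading
    there has density \<open>f\<^sub>1\<close>, which is thus finite almost everywhere.\<close>
  have fin: "AE x in \<mu>. f\<^sub>0 x \<noteq> top \<and> f\<^sub>1 x \<noteq> top"
  proof -
    interpret Z: sensor_law "Pr 0" 0 \<mu> f\<^sub>0 f\<^sub>1 \<pi> r p\<^sub>0 p\<^sub>1 S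
      by (rule law)
    have "AE x in \<mu>. f\<^sub>0 x \<noteq> top"
      using Z.AE_distributed_density_finite[OF Z.init_reading_law[of 1]] by simp
    moreover have "AE x in \<mu>. f\<^sub>1 x \<noteq> top"
      using Z.AE_distributed_density_finite[OF Z.reading_law[of 1]] by (simp add: zero_enat_def)
    ultimately show ?thesis
      by eventually_elim simp
  qed
  show "AE \<omega> in Pr \<nu>'.
    log_likelihood_ratio Pr \<mu> S \<nu> n \<omega> =
      (\<Sum>k=1..n.
         (if norm0 (queue S k \<omega>) > 0
          then eln (channel_likelihood (Pr (enat \<nu>)) S k \<omega> / channel_likelihood (Pr \<infinity>) S k \<omega>)
          else 0) +
         (if obs_Y S k \<omega> = Some True \<and>
             the (obs_J S k \<omega>) > init_queue S \<omega> (the (obs_U S k \<omega>))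
               + arrivals S \<nu> \<omega> (the (obs_U S k \<omega>))
          then eln (f\<^sub>1 (packet S (the (obs_J S k \<omega>)) (the (obs_U S k \<omega>)) \<omega>) /
                    f\<^sub>0 (packet S (the (obs_J S k \<omega>)) (the (obs_U S k \<omega>)) \<omega>))
          else 0))"
    using obs L.AE_start_event[of \<nu>] L.AE_packet[OF fin] L.AE_init_queue
  proof eventually_elim
    case (elim \<omega>)
    let ?q = "init_queue S \<omega>" and ?a = "arrivals S \<nu> \<omega>" and ?v = "observations S n \<omega>"
    define G where "G = emeasure (Pr \<nu>') (path_event (Pr \<infinity>) S \<nu> ?q ?a n (\<lambda>k\<in>{1..n}. obs_U S k \<omega>)
      (\<lambda>k\<in>{1..n}. obs_Y S k \<omega>) (\<lambda>k\<in>{1..n}. obs_J S k \<omega>)) / emeasure (Pr \<nu>') (B ?q ?a)"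
    define C where "C \<rho> k = channel_density \<rho> p\<^sub>0 p\<^sub>1 k (obs_Y S k \<omega>)" for \<rho> k
    define F where "F \<rho> k = reading_density \<rho> f\<^sub>0 f\<^sub>1 ?q ?a (obs_U S k \<omega>) (obs_J S k \<omega>) (obs_Z S k \<omega>)" for \<rho> k
    have h: "?h \<rho> ?q ?a n ?v = G * (\<Prod>k\<in>{1..n}. C \<rho> k * F \<rho> k)" for \<rho>
      by (simp add: obs_density_observations path[of \<rho>] inv[of \<rho>] B Binv[of \<rho>] G_def C_def F_def)
    have B0: "emeasure (Pr \<nu>') (B ?q ?a) \<noteq> 0"
      using elim(2) by (simp add: B)
    have lik: "obs_likelihood (Pr \<rho>) \<mu> S \<nu> n \<omega> = G * (\<Prod>k\<in>{1..n}. C \<rho> k * F \<rho> k)"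
      if "\<rho> \<in> {enat \<nu>, \<infinity>}" for \<rho>
    proof -
      have "obs_likelihood (Pr \<rho>) \<mu> S \<nu> n \<omega> =
          RN_deriv ?N (distr (uniform_measure (Pr \<rho>) (B ?q ?a)) ?N (observations S n)) ?v"
        by (simp add: obs_likelihood_def cond_density_def B[of \<rho>, unfolded start_event_def])
      also have "\<dots> = ?h \<rho> ?q ?a n ?v"
        using elim(1) that B0 unfolding good_def by metis
      finally show ?thesis
        unfolding h .
    qed
    \<comment> \<open>Positivity of the density of the law in force makes \<open>G\<close> and all
      factors of that law nonzero, which yields the alternative required by
      \<open>eln_likelihood_ratio\<close>.\<close>
    have pos: "0 < G * (\<Prod>k\<in>{1..n}. C \<nu>' k * F \<nu>' k)"
      using elim(1) by (simp add: h)
    have C_fin: "C \<rho> k \<noteq> top" for \<rho> k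
      by (simp add: C_def channel_density_def split: option.split)
    have Z: "obs_Z S k \<omega> = map_option (\<lambda>l. packet S (the (obs_J S k \<omega>)) l \<omega>) (obs_U S k \<omega>)" for k
      by (simp add: obs_Z_def)
    have F_fin: "F \<rho> k \<noteq> top" if "k \<in> {1..n}" for \<rho> k
      using elim(3) that by (cases "obs_U S k \<omega>") (auto simp: F_def Z reading_density_def packet_density_def)
    have "emeasure (Pr \<nu>') A \<noteq> top" for A
      by simp
    then have G: "G \<noteq> 0" "G \<noteq> top"
      using pos B0 by (auto simp: G_def ennreal_divide_eq_top_iff)
    have CF: "C \<nu>' k \<noteq> 0 \<and> F \<nu>' k \<noteq> 0" if "k \<in> {1..n}" for k
      using pos that by (auto simp: zero_less_iff_neq_zero)
    have "log_likelihood_ratio Pr \<mu> S \<nu> n \<omega> =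
        (\<Sum>k=1..n. eln (C (enat \<nu>) k / C \<infinity> k) + eln (F (enat \<nu>) k / F \<infinity> k))"
      unfolding log_likelihood_ratio_def using \<nu>'
      by (subst lik, simp, subst lik, simp, intro eln_likelihood_ratio G)
        (use C_fin F_fin CF in auto)
    also have "\<dots> = (\<Sum>k=1..n.
         (if norm0 (queue S k \<omega>) > 0
          then eln (channel_likelihood (Pr (enat \<nu>)) S k \<omega> / channel_likelihood (Pr \<infinity>) S k \<omega>)
          else 0) +
         (if obs_Y S k \<omega> = Some True \<and>
             the (obs_J S k \<omega>) > ?q (the (obs_U S k \<omega>)) + ?a (the (obs_U S k \<omega>))
          then eln (f\<^sub>1 (packet S (the (obs_J S k \<omega>)) (the (obs_U S k \<omega>)) \<omega>) /
                    f\<^sub>0 (packet S (the (obs_J S k \<omega>)) (the (obs_U S k \<omega>)) \<omega>))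
          else 0))"
    proof (intro sum.cong refl arg_cong2[where f = "(+)"])
      fix k assume k: "k \<in> {1..n}"
      show "eln (C (enat \<nu>) k / C \<infinity> k) = (if norm0 (queue S k \<omega>) > 0
          then eln (channel_likelihood (Pr (enat \<nu>)) S k \<omega> / channel_likelihood (Pr \<infinity>) S k \<omega>)
          else 0)"
        \<comment> \<open>In a busy slot the likelihoods are the channel densities of the two laws;
          in an idle one both densities are 1.\<close>
        using sensor_law.channel_likelihood_eq[OF law _ r elim(4)] k
        by (simp add: C_def) (simp add: obs_Y_def channel_density_def)
      show "eln (F (enat \<nu>) k / F \<infinity> k) = (if obs_Y S k \<omega> = Some True \<and>
             the (obs_J S k \<omega>) > ?q (the (obs_U S k \<omega>)) + ?a (the (obs_U S k \<omega>))
          then eln (f\<^sub>1 (packet S (the (obs_J S k \<omega>)) (the (obs_U S k \<omega>)) \<omega>) /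
                    f\<^sub>0 (packet S (the (obs_J S k \<omega>)) (the (obs_U S k \<omega>)) \<omega>))
          else 0)"
      proof (cases "obs_U S k \<omega>")
        case None
        then have "obs_Y S k \<omega> \<noteq> Some True"
          by (auto simp: obs_U_def split: if_splits)
        with None show ?thesis
          by (simp add: F_def Z reading_density_def)
      next
        case (Some l)
        have Y: "obs_Y S k \<omega> = Some True"
          using obs_U_eq_SomeD[OF Some] .
        have F: "F \<rho> k = packet_density \<rho> f\<^sub>0 f\<^sub>1 ?q ?a l (the (obs_J S k \<omega>)) (packet S (the (obs_J S k \<omega>)) l \<omega>)" for \<rho>
          by (simp add: F_def Z Some reading_density_def)
        show ?thesis
        proof (cases "the (obs_J S k \<omega>) \<le> ?q l + ?a l")
          case True
          \<comment> \<open>Up to the threshold both laws use \<open>f\<^sub>0\<close>; its value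
            here is nonzero and finite, so the ratio is 1.\<close>
          then have "F (enat \<nu>) k = F \<nu>' k" "F \<infinity> k = F \<nu>' k"
            by (simp_all add: F packet_density_def)
          then show ?thesis
            using CF[OF k] F_fin[OF k] True by (simp add: Some Y eln_divide_self)
        next
          case False
          then show ?thesis
            by (simp add: F Some Y packet_density_def)
        qed
      qed
    qed
    finally show ?case .
  qed
qed

end
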